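(* Let $A=(q,q^4;q^5)_\infty$, $B=(q^2,q^3;q^5)_\infty$, $E_1=(q;q)_\infty$, $E_5=(q^5;q^5)_\infty$ and $S=\sum_{n=-\infty}^{\infty}(-1)^n n\, q^{n(5n+1)/2}$. For $r\in\{0,3,4\}$ write $F_r(q)=\sum_{n\ge0}\big[NB_4(1,5,5n+r)-NB_4(4,5,5n+r)+2NB_4(2,5,5n+r)-2NB_4(3,5,5n+r)\big]q^n$. Then \begin{align*} F_0(q)=\;&5S\Big(-7q^3\frac{A^6E_5^9}{B^8E_1^{12}}+12q^2\frac{A\,E_5^9}{B^3E_1^{12}}-4q\frac{B^2E_5^9}{A^4E_1^{12}}-9\frac{B^7E_5^9}{A^9E_1^{12}}+20q^2\frac{A^4E_5^7}{B^5E_1^{12}}-5q\frac{E_5^7}{A\,E_1^{12}}+5\frac{B^5E_5^7}{A^6E_1^{12}}\Big)\\ &+10q^2\frac{A^4E_5^8}{B^4E_1^{12}}-\frac52q\frac{B\,E_5^8}{A\,E_1^{12}}+\frac52\frac{B^6E_5^8}{A^6E_1^{12}}-\frac{305}{2}q^3\frac{A^3E_5^{12}}{B^5E_1^{12}}+\frac{335}{2}q^2\frac{E_5^{12}}{A^2E_1^{12}}+85q\frac{B^5E_5^{12}}{A^7E_1^{12}}\\ &+5\frac{B^{10}E_5^{12}}{A^{12}E_1^{12}}+25q^3\frac{A^6E_5^{10}}{B^7E_1^{12}}-15q^2\frac{A\,E_5^{10}}{B^2E_1^{12}}-10q\frac{B^3E_5^{10}}{A^4E_1^{12}}-\frac{15}{2}\frac{B^8E_5^{10}}{A^9E_1^{12}},\\[4pt]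 F_3(q)=\;&55q^3\frac{A^6E_5^{12}}{B^8E_1^{12}}-\frac{335}{2}q^2\frac{A\,E_5^{12}}{B^3E_1^{12}}+260q\frac{B^2E_5^{12}}{A^4E_1^{12}}+\frac{45}{2}\frac{B^7E_5^{12}}{A^9E_1^{12}}-5q^2\frac{A^4E_5^{10}}{B^5E_1^{12}}-\frac{35}{2}q\frac{E_5^{10}}{A\,E_1^{12}}-\frac{15}{2}\frac{B^5E_5^{10}}{A^6E_1^{12}},\\[4pt] F_4(q)=\;&-\frac{45}{2}q^3\frac{A^7E_5^{12}}{B^9E_1^{12}}+260q^2\frac{A^2E_5^{12}}{B^4E_1^{12}}+\frac{335}{2}q\frac{B\,E_5^{12}}{A^3E_1^{12}}+55\frac{B^6E_5^{12}}{A^8E_1^{12}}+\frac52q^2\frac{A^5E_5^{10}}{B^6E_1^{12}}+\frac52q\frac{E_5^{10}}{B\,E_1^{12}}-15\frac{B^4E_5^{10}}{A^5E_1^{12}}. \end{align*}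
   Context: Notation: $(a;q)_\infty=\prod_{n\ge0}(1-aq^n)$ and $(a_1,\dots,a_t;q)_\infty=(a_1;q)_\infty\cdots(a_t;q)_\infty$; identities are of formal power series in $q$ (equivalently analytic for $|q|<1$). For $k\ge2$, a $k$-colored partition of $n\ge0$ is a $k$-tuple $\pi=(\pi^{(1)},\dots,\pi^{(k)})$ of ordinary partitions with $|\pi^{(1)}|+\cdots+|\pi^{(k)}|=n$ (written $\pi\vdash n$); $\#(\pi^{(i)})$ is the number of parts of $\pi^{(i)}$, and $\mathrm{crank}_k(\pi)=\#(\pi^{(1)})-\#(\pi^{(2)})$. For $k\ge2$, $j\ge2$, $0\le m\le j-1$, $n\ge0$, $$NB_k(m,j,n)=\sum_{\pi\vdash n,\ \mathrm{crank}_k(\pi)\equiv m \pmod j}\#(\pi^{(1)}).$$ *)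

theory Defs
  imports
    "HOL-Analysis.Analysis"
    "HOL-Computational_Algebra.Formal_Power_Series"
    "HOL-Library.Multiset"
    "HOL-Number_Theory.Cong"
begin

text \<open>
  Formal power series carry the metric topology of \<^theory>\<open>HOL-Computational_Algebra.Formal_Power_Series\<close>
  (coefficientwise stabilisation). Infinite products and the bilateral sum below are limits in
  that topology; the convergence facts that make \<^const>\<open>prodinf\<close> and \<^const>\<open>infsum\<close> meaningful
  are proved at the end of the theory.
\<close>

definition qpoch :: "complex fps \<Rightarrow> complex fps \<Rightarrow> complex fps" where
  "qpoch a q = (\<Prod>n. 1 - a * q ^ n)"

definition qpochs :: "complex fps list \<Rightarrow> complex fps \<Rightarrow> complex fps" where
  "qpochs as q = (\<Prod>a\<leftarrow>as. qpoch a q)"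

text \<open>An ordinary partition is the finite multiset of its (positive) parts: \<^const>\<open>sum_mset\<close> is its
  weight and \<^const>\<open>size\<close> its number of parts.\<close>

definition is_partition :: "nat multiset \<Rightarrow> bool" where
  "is_partition p \<longleftrightarrow> 0 \<notin># p"

text \<open>A \<open>k\<close>-tuple is a list of length \<open>k\<close>, so the components called $1$ and $2$ in the
  literature have list indices $0$ and $1$.\<close>

definition colored_partitions :: "nat \<Rightarrow> nat \<Rightarrow> nat multiset list set" where
  "colored_partitions k n =
     {\<pi>. length \<pi> = k \<and> (\<forall>p\<in>set \<pi>. is_partition p) \<and> (\<Sum>p\<leftarrow>\<pi>. sum_mset p) = n}"

definition crank :: "nat multiset list \<Rightarrow> int" where
  "crank \<pi> = int (size (\<pi> ! 0)) - int (size (\<pi> ! 1))"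

text \<open>Only meaningful for \<open>k \<ge> 2\<close>, \<open>j \<ge> 2\<close> and \<open>m < j\<close>.\<close>

definition NB :: "nat \<Rightarrow> nat \<Rightarrow> nat \<Rightarrow> nat \<Rightarrow> nat" where
  "NB k m j n =
     (\<Sum>\<pi> \<in> {\<pi> \<in> colored_partitions k n. [crank \<pi> = int m] (mod int j)}. size (\<pi> ! 0))"

definition F_series :: "nat \<Rightarrow> complex fps" where
  "F_series r = Abs_fps (\<lambda>n.
       of_nat (NB 4 1 5 (5*n+r)) - of_nat (NB 4 4 5 (5*n+r))
       + 2 * of_nat (NB 4 2 5 (5*n+r)) - 2 * of_nat (NB 4 3 5 (5*n+r)))"

text \<open>The exponent \<open>n * (5 * n + 1) div 2\<close> is an exact division and is never negative.\<close>

definition S_series :: "complex fps \<Rightarrow> complex fps" where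
  "S_series q =
     (\<Sum>\<^sub>\<infinity>n::int. (-1) powi n * of_int n * q ^ nat (n * (5 * n + 1) div 2))"

lemma finite_colored_partitions: "finite (colored_partitions k n)"
proof -
  let ?P = "{p. is_partition p \<and> sum_mset p \<le> n}"
  have size_le: "size p \<le> sum_mset p" if "is_partition p" for p
    using that unfolding is_partition_def by (induction p) auto
  have elem_le: "x \<le> sum_mset p" if "x \<in># p" for x and p :: "nat multiset"
    using that by (induction p) auto
  have "?P \<subseteq> mset ` {xs. set xs \<subseteq> {..n} \<and> length xs \<le> n}"
  proof
    fix p assume p: "p \<in> ?P"
    obtain xs where xs: "p = mset xs" using ex_mset by metis
    have "set xs \<subseteq> {..n}" using p elem_le[of _ p] xs by (auto intro: le_trans)
    moreover have "length xs \<le> n" using p size_le[of p] xs by simp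
    ultimately show "p \<in> mset ` {xs. set xs \<subseteq> {..n} \<and> length xs \<le> n}" using xs by blast
  qed
  then have "finite ?P"
    by (rule finite_subset) (intro finite_imageI finite_lists_length_le finite_atMost)
  then have "finite {\<pi>. set \<pi> \<subseteq> ?P \<and> length \<pi> = k}"
    by (rule finite_lists_length_eq)
  moreover have "colored_partitions k n \<subseteq> {\<pi>. set \<pi> \<subseteq> ?P \<and> length \<pi> = k}"
    unfolding colored_partitions_def by (auto intro!: member_le_sum_list)
  ultimately show ?thesis by (rule rev_finite_subset)
qed

lemma qpoch_has_prod:
  fixes i s :: nat
  assumes "i > 0" "s > 0"
  shows "(\<lambda>n. 1 - fps_X ^ i * (fps_X ^ s) ^ n) has_prod qpoch (fps_X ^ i) (fps_X ^ s)"
proof -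
  let ?f = "\<lambda>n. 1 - fps_X ^ i * (fps_X ^ s) ^ n :: complex fps"
  let ?g = "\<lambda>N. \<Prod>n\<le>N. ?f n"
  have one_step: "fps_nth (?g (Suc N)) d = fps_nth (?g N) d" if "d \<le> N" for N d
  proof -
    have "?g (Suc N) = ?g N - fps_X ^ (i + s * Suc N) * ?g N"
      by (simp only: prod.atMost_Suc power_mult power_add right_diff_distrib mult_1_right
          mult.commute[of "?g N"])
    moreover have "N \<le> s * N" using assms by simp
    then have "d < i + s * Suc N" using that assms unfolding mult_Suc_right by linarith
    ultimately show ?thesis by (simp add: fps_X_power_mult_nth)
  qed
  have stable: "fps_nth (?g N) d = fps_nth (?g d) d" if "d \<le> N" for N d
    using that
  proof (induction N rule: dec_induct)
    case base
    show ?case by (rule refl)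
  next
    case (step N)
    show ?case using one_step[OF step.hyps(1)] step.IH by (rule trans)
  qed
  let ?p = "Abs_fps (\<lambda>d. fps_nth (?g d) d)"
  have "?g \<longlonglongrightarrow> ?p"
  proof (rule tendsto_fpsI)
    fix d show "eventually (\<lambda>N. fps_nth (?g N) d = fps_nth ?p d) sequentially"
      unfolding eventually_sequentially fps_nth_Abs_fps using stable by blast
  qed
  moreover have "fps_nth ?p 0 = 1" using assms by simp
  then have "?p \<noteq> 0" by (metis fps_zero_nth zero_neq_one)
  ultimately have hp: "?f has_prod ?p"
    unfolding has_prod_def raw_has_prod_def add_0_right by blast
  show ?thesis unfolding qpoch_def has_prod_unique[OF hp, symmetric] by (rule hp)
qed

lemma summable_S_series:
  "(\<lambda>n::int. (-1) powi n * of_int n * (fps_X :: complex fps) ^ nat (n * (5 * n + 1) div 2))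
     summable_on UNIV"
proof -
  let ?e = "\<lambda>n::int. nat (n * (5 * n + 1) div 2)"
  let ?t = "\<lambda>n::int. (-1) powi n * of_int n * (fps_X :: complex fps) ^ ?e n"
  have bound: "n \<in> {- int d..int d}" if "?e n \<le> d" for n d
  proof -
    have "\<bar>n\<bar> * 2 \<le> n * (5 * n + 1)"
    proof (cases "n \<ge> 1 \<or> n \<le> -1")
      case True
      then have "\<bar>n\<bar> * 2 \<le> \<bar>n\<bar> * \<bar>5 * n + 1\<bar>" by (intro mult_left_mono) auto
      also have "\<dots> = n * (5 * n + 1)" using True by (auto simp: abs_if algebra_simps)
      finally show ?thesis .
    next
      case False
      then have "n = 0" by linarith
      then show ?thesis by simp
    qed
    then have "\<bar>n\<bar> \<le> n * (5 * n + 1) div 2" by linarith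
    then show ?thesis using that by auto
  qed
  have nth: "fps_nth (?t n) d = 0" if "n \<notin> {- int d..int d}" for n d
  proof -
    have "d < ?e n" using bound[of n d] that by linarith
    then show ?thesis by (simp only: fps_X_power_mult_right_nth if_True)
  qed
  let ?s = "Abs_fps (\<lambda>d. \<Sum>n\<in>{- int d..int d}. fps_nth (?t n) d)"
  have "(?t has_sum ?s) UNIV"
    unfolding has_sum_def
  proof (rule tendsto_fpsI)
    fix d
    have "fps_nth (sum ?t X) d = fps_nth ?s d" if "finite X" "{- int d..int d} \<subseteq> X" for X
    proof -
      have "(\<Sum>n\<in>X. fps_nth (?t n) d) = (\<Sum>n\<in>{- int d..int d}. fps_nth (?t n) d)"
        using that nth by (intro sum.mono_neutral_right) blast+
      then show ?thesis by (simp only: fps_sum_nth fps_nth_Abs_fps)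
    qed
    then show "eventually (\<lambda>X. fps_nth (sum ?t X) d = fps_nth ?s d) (finite_subsets_at_top UNIV)"
      unfolding eventually_finite_subsets_at_top by (intro exI[of _ "{- int d..int d}"] conjI allI impI) (simp_all only: finite_atLeastAtMost_int subset_UNIV)
  qed
  then show ?thesis unfolding summable_on_def by blast
qed

end

theory Submission
  imports Defs
begin

text \<open>
  Weighting a 4-coloured partition by the odd function $1, 2, -2, -1$ of its crank modulo 5 and
  exchanging the first two colours turns the left-hand sides into the coefficients of
  $\sum_j c_j C'(\zeta^j)$, where $C(z)$ is the crank generating function, $\zeta$ a primitive
  fifth root of unity and $C' = z\,dC/dz$. Since $C(z)\,(q;q)_\infty\,\theta(z) = 1 - 1/z$ for
  $\theta(z) = \sum_n (-1)^n z^n q^{n(n+1)/2}$, everything is expressed by $\theta(\zeta)$ and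
  $\theta'(\zeta)$.

  Dissecting these sums modulo 5, with $x = B(q^5)$, $y = q A(q^5)$ and $D = (q^{25};q^{25})_\infty$, gives
  $\theta(\zeta) = (1 - \zeta^{-1}) D (x + t y)$ for $t = \zeta^2 + \zeta^3$, and the conjugate of
  this factor completes it to $E_1 E_5 = D^2 (x^2 - xy - y^2)$. Multiplying the images of this
  identity under $q \mapsto \zeta^k q$ gives $x^{10} - 11 x^5 y^5 - y^{10} = (AB)(q^5)^{11}$, hence a
  polynomial expression for $1 / E_1$. The derivative at $z = 1$ is Jacobi's $E_1^3$; comparing its
  dissection with the cube of $E_1$ evaluates $S$ and its companion
  $\sum_n (-1)^n n q^{n(5n+3)/2}$, and with them $\theta'(\zeta)$. The generating function is then a
  polynomial in $x$ and $y$ over series in $q^5$, and the theorem lists its residue classes.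
\<close>

text \<open>The formula for C'(\<zeta>) has theta(\<zeta>)^2 in its denominator, while its numerator
  contains S and the companion. Once these two are expressed by x, y and D, the numerator turns out
  to be divisible by x + t y, so one factor theta(\<zeta>) cancels. The conjugate factor x - (1 + t)
  y completes the other one to E_1 E_5, and adding the contribution of \<zeta>^2, where t becomes -1
  - t, removes every irrationality. The denominator left over is essentially (x^2 - x y - y^2)^2;
  the cofactor of x^2 - x y - y^2 in the norm form turns it into a power of (AB)(q^5), after which
  the residue class of a monomial is its exponent of y modulo 5.

  The right-hand side of F_0 still contains S. Since S is itself rational in q, A, B, E_5, each
  claim becomes, over a common denominator, a polynomial identity in these four series; apart from
  the value of S and E_1 = A B E_5, no relation between them enters the final comparison.\<close>

section \<open>Limits and bilateral sums of formal power series\<close>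

unbundle no vec_syntax
unbundle fps_syntax

text \<open>This simproc would turn equations between series in \<open>fps_X\<close> into equations between polynomials.\<close>

declare [[simproc del: poly_fps_eq]]

text \<open>A coefficient of a product involves only finitely many coefficients of the factors, and
  each of those eventually equals its limit.\<close>

lemma tendsto_mult_fps:
  fixes f g :: "'b \<Rightarrow> 'a::ring fps"
  assumes "(f \<longlongrightarrow> a) F" "(g \<longlongrightarrow> b) F"
  shows "((\<lambda>x. f x * g x) \<longlongrightarrow> a * b) F"
proof (rule tendsto_fpsI)
  fix n
  have "\<forall>\<^sub>F x in F. \<forall>i\<in>{..n}. f x $ i = a $ i" "\<forall>\<^sub>F x in F. \<forall>i\<in>{..n}. g x $ i = b $ i"
    using assms by (simp_all add: tendsto_fps_iff eventually_ball_finite)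
  then show "\<forall>\<^sub>F x in F. (f x * g x) $ n = (a * b) $ n"
    by eventually_elim (simp add: fps_mult_nth)
qed

lemma tendsto_compose_fps:
  fixes f :: "'b \<Rightarrow> 'a::comm_ring_1 fps"
  assumes "(f \<longlongrightarrow> a) F"
  shows "((\<lambda>x. f x oo g) \<longlongrightarrow> a oo g) F"
proof (rule tendsto_fpsI)
  fix n
  have "\<forall>\<^sub>F x in F. \<forall>i\<in>{0..n}. f x $ i = a $ i"
    using assms by (simp add: tendsto_fps_iff eventually_ball_finite)
  then show "\<forall>\<^sub>F x in F. (f x oo g) $ n = (a oo g) $ n"
    by eventually_elim (simp add: fps_compose_nth)
qed

text \<open>Partial products of \<open>qpoch\<close>. Product identities are proved for these and
  then passed to the limit, so that no infinite product has to be rearranged.\<close>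

definition qprod :: "nat \<Rightarrow> 'a::comm_ring_1 \<Rightarrow> 'a \<Rightarrow> 'a" where
  "qprod N a q = (\<Prod>n<N. 1 - a * q ^ n)"

lemma qprod_0 [simp]: "qprod 0 a q = 1"
  and qprod_Suc: "qprod (Suc N) a q = qprod N a q * (1 - a * q ^ N)"
  by (simp_all add: qprod_def)

lemma qprod_Suc_shift: "qprod (Suc N) a q = (1 - a) * qprod N (a * q) q"
  unfolding qprod_def by (subst prod.lessThan_Suc_shift) (simp add: mult.assoc)

lemma qprod_nth_0 [simp]:
  fixes a q :: "'a::comm_ring_1 fps"
  assumes "a $ 0 = 0"
  shows "qprod N a q $ 0 = 1"
  by (induction N) (simp_all add: qprod_Suc assms)

lemma qprod_tendsto_qpoch:
  assumes "i > 0" "s > 0"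
  shows "(\<lambda>N. qprod N (fps_X ^ i) (fps_X ^ s)) \<longlonglongrightarrow> qpoch (fps_X ^ i) (fps_X ^ s)"
proof -
  let ?f = "\<lambda>n. 1 - fps_X ^ i * (fps_X ^ s) ^ n :: complex fps"
  \<comment> \<open>\<open>has_prod\<close> may skip an initial segment that contains a vanishing
    factor; without such factors it is the plain limit of the partial products.\<close>
  have "?f n \<noteq> 0" for n
  proof -
    have "?f n $ 0 = 1" using assms by simp
    then show ?thesis by (metis fps_zero_nth zero_neq_one)
  qed
  then have "(\<lambda>N. \<Prod>n\<le>N. ?f n) \<longlonglongrightarrow> qpoch (fps_X ^ i) (fps_X ^ s)"
    using qpoch_has_prod[OF assms] unfolding has_prod_def raw_has_prod_def by auto
  then show ?thesis
    unfolding qprod_def by (subst (asm) LIMSEQ_lessThan_iff_atMost[symmetric])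
qed

text \<open>The bilateral sum of \<open>c n * X ^ e n\<close>, collected by exponent. An infinite
  fibre would contribute 0 by the convention for \<open>sum\<close>, so the definition has its
  intended meaning only when every exponent is attained finitely often. Rearrangements then become
  statements about single coefficients.\<close>

definition fibre_sum :: "(int \<Rightarrow> 'a::comm_ring_1) \<Rightarrow> (int \<Rightarrow> nat) \<Rightarrow> 'a fps" where
  "fibre_sum c e = Abs_fps (\<lambda>d. \<Sum>n | e n = d. c n)"

lemma fibre_sum_has_sum:
  assumes "\<And>d. finite {n. e n \<le> d}"
  shows "((\<lambda>n. fps_const (c n) * fps_X ^ e n) has_sum fibre_sum c e) UNIV"
proof -
  have fin: "finite {n. e n = d}" for d
    by (rule finite_subset[OF _ assms[of d]]) auto
  have nz: "{n \<in> UNIV. (fps_const (c n) * fps_X ^ e n) $ d \<noteq> 0} \<subseteq> {n. e n = d}" for d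
    by (auto simp: fps_X_power_mult_right_nth split: if_splits)
  show ?thesis
  proof (rule has_sum_fpsI)
    fix d
    show "finite {n \<in> UNIV. (fps_const (c n) * fps_X ^ e n) $ d \<noteq> 0}"
      by (rule finite_subset[OF nz fin])
    have "(\<Sum>n | n \<in> UNIV \<and> (fps_const (c n) * fps_X ^ e n) $ d \<noteq> 0. (fps_const (c n) * fps_X ^ e n) $ d)
      = (\<Sum>n | e n = d. (fps_const (c n) * fps_X ^ e n) $ d)"
      by (intro sum.mono_neutral_left fin nz) auto
    also have "\<dots> = (\<Sum>n | e n = d. c n)"
      by (intro sum.cong) auto
    finally show "fibre_sum c e $ d = (\<Sum>n | n \<in> UNIV \<and> (fps_const (c n) * fps_X ^ e n) $ d \<noteq> 0.
        (fps_const (c n) * fps_X ^ e n) $ d)"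
      by (simp add: fibre_sum_def)
  qed
qed

lemma fibre_sum_add: "fibre_sum c e + fibre_sum c' e = fibre_sum (\<lambda>n. c n + c' n) e"
  by (simp add: fibre_sum_def fps_eq_iff sum.distrib)

lemma fibre_sum_cmult: "fps_const a * fibre_sum c e = fibre_sum (\<lambda>n. a * c n) e"
  by (simp add: fibre_sum_def fps_eq_iff sum_distrib_left)

lemma fibre_sum_minus: "- fibre_sum c e = fibre_sum (\<lambda>n. - c n) e"
  by (simp add: fibre_sum_def fps_eq_iff sum_negf)

lemma fibre_sum_reindex:
  assumes "bij h"
  shows "fibre_sum (\<lambda>n. c (h n)) (\<lambda>n. e (h n)) = fibre_sum c e"
proof -
  have "(\<Sum>n | e (h n) = d. c (h n)) = (\<Sum>n | e n = d. c n)" for d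
  proof (rule sum.reindex_bij_betw)
    have "h ` {n. e (h n) = d} = {n. e n = d}"
      using bij_is_surj[OF assms] by (auto simp: image_iff surj_def)
    then show "bij_betw h {n. e (h n) = d} {n. e n = d}"
      using bij_is_inj[OF assms] by (auto simp: bij_betw_def intro: inj_on_subset)
  qed
  then show ?thesis by (simp add: fibre_sum_def fps_eq_iff)
qed

lemma fibre_sum_shift: "fps_X ^ r * fibre_sum c e = fibre_sum c (\<lambda>n. e n + r)"
proof -
  have "{n. e n + r = d} = (if d < r then {} else {n. e n = d - r})" for d by auto
  then show ?thesis
    by (auto simp: fibre_sum_def fps_eq_iff fps_X_power_mult_nth)
qed

lemma fps_nth_compose_X_power:
  "(f oo fps_X ^ d) $ n = (if d dvd n then f $ (n div d) else 0)" for f :: "'a::comm_ring_1 fps"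
proof -
  have "(f oo fps_X ^ d) $ n = (\<Sum>i = 0..n. f $ i * (fps_X ^ (d * i)) $ n)"
    unfolding fps_compose_def by (simp add: power_mult)
  also have "\<dots> = (\<Sum>i\<in>(if d dvd n then {n div d} else {}). f $ i * (fps_X ^ (d * i)) $ n)"
    by (intro sum.mono_neutral_right) auto
  finally show ?thesis by auto
qed

lemma fibre_sum_compose_power:
  assumes "k > 0"
  shows "fibre_sum c e oo fps_X ^ k = fibre_sum c (\<lambda>n. k * e n)"
proof -
  have "{n. k * e n = d} = (if k dvd d then {n. e n = d div k} else {})" for d
    using assms by auto
  then show ?thesis
    by (auto simp: fibre_sum_def fps_eq_iff fps_nth_compose_X_power)
qed

lemma fibre_sum_split_mod:
  assumes fin: "\<And>d. finite {n. e n \<le> d}" and "k > 0"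
  shows "fibre_sum c e = (\<Sum>r<k. fibre_sum (\<lambda>m. c (int k * m + int r)) (\<lambda>m. e (int k * m + int r)))"
proof (rule fps_ext)
  fix d
  have fin': "finite {n. e n = d}"
    by (rule finite_subset[OF _ fin[of d]]) auto
  let ?r = "\<lambda>n. nat (n mod int k)"
  have eq: "(\<Sum>n | n \<in> {n. e n = d} \<and> ?r n = r. c n)
      = (\<Sum>m | e (int k * m + int r) = d. c (int k * m + int r))" if "r < k" for r
  proof (rule sum.reindex_bij_betw[symmetric])
    show "bij_betw (\<lambda>m. int k * m + int r) {m. e (int k * m + int r) = d}
        {n. n \<in> {n. e n = d} \<and> ?r n = r}"
    proof (rule bij_betw_imageI)
      show "inj_on (\<lambda>m. int k * m + int r) {m. e (int k * m + int r) = d}"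
        using \<open>k > 0\<close> by (auto simp: inj_on_def)
      show "(\<lambda>m. int k * m + int r) ` {m. e (int k * m + int r) = d} = {n. n \<in> {n. e n = d} \<and> ?r n = r}"
      proof (intro equalityI subsetI)
        fix n assume n: "n \<in> {n. n \<in> {n. e n = d} \<and> ?r n = r}"
        then have "int r = n mod int k" using \<open>k > 0\<close> by auto
        then have "n = int k * (n div int k) + int r" by simp
        then show "n \<in> (\<lambda>m. int k * m + int r) ` {m. e (int k * m + int r) = d}"
          using n by (intro image_eqI) auto
      qed (use that in auto)
    qed
  qed
  have "(\<Sum>n | e n = d. c n) = (\<Sum>r<k. \<Sum>n | n \<in> {n. e n = d} \<and> ?r n = r. c n)"
    using \<open>k > 0\<close> by (intro sum.group[symmetric] fin') (auto simp: nat_less_iff)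
  also have "\<dots> = (\<Sum>r<k. \<Sum>m | e (int k * m + int r) = d. c (int k * m + int r))"
    by (intro sum.cong refl eq) simp
  finally show "fibre_sum c e $ d
      = (\<Sum>r<k. fibre_sum (\<lambda>m. c (int k * m + int r)) (\<lambda>m. e (int k * m + int r))) $ d"
    by (simp add: fibre_sum_def fps_sum_nth)
qed

section \<open>The Jacobi triple product\<close>

text \<open>The polynomial core of \<open>qbinom_mid_rec\<close>: there p and t are powers of
  \<open>Q\<close> and r is \<open>Q\<close> itself.\<close>

lemma qbinom_pascal_aux:
  fixes p t r :: "'a::comm_ring_1"
  shows "(1 - p * t * r) * (1 - p * t * (r * r)) = (1 + p * t * r) * (1 - p * r) * (1 - t * r)
    + t * r * ((1 - p) * (1 - p * r)) + p * r * ((1 - t) * (1 - t * r))"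
  by (simp add: algebra_simps)

text \<open>The product has base X^s and arguments a X^i and X^j / a, whose product must be X^s.
  Allowing j = 0 covers the theta series of the crank (i = s = 1, a = z); a = 1 and s = 5 cover A
  and B.\<close>

locale jacobi_triple =
  fixes i j s :: nat and a :: "'a::field_char_0"
  assumes a: "a \<noteq> 0" and ij: "i + j = s" and s: "s > 0"
begin


definition theta_exp :: "int \<Rightarrow> nat" where
  "theta_exp n = nat (int s * (n * (n - 1) div 2) + int i * n)"

text \<open>The exponent is nonnegative, so \<open>nat\<close> truncates nothing, and it grows with
  |n|, so its fibres are finite. With t = n(n-1)/2, for n >= 1 this comes from t >= n - 1; for n <=
  0, i <= s bounds the exponent below by s (t + n), and t + n >= -n - 1.\<close>

lemma theta_exp_int: "int (theta_exp n) = int s * (n * (n - 1) div 2) + int i * n"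
  and theta_exp_ge: "\<bar>n\<bar> \<le> int (theta_exp n) + 1"
proof -
  obtain t where t: "n * (n - 1) = 2 * t"
    by (rule evenE[of "n * (n - 1)"]) auto
  have "0 \<le> int s * t + int i * n \<and> \<bar>n\<bar> \<le> int s * t + int i * n + 1"
  proof (cases "n \<ge> 1")
    case True
    have "(n - 1) * (n - 2) \<ge> 0" using True by (cases "n = 1") auto
    then have "t \<ge> n - 1" using t by (simp add: algebra_simps)
    moreover have "int s * t \<ge> 1 * t" using s \<open>t \<ge> n - 1\<close> True by (intro mult_right_mono) auto
    moreover have "int i * n \<ge> 0" using True by simp
    ultimately show ?thesis using True by linarith
  next
    case False
    have "n * (n + 3) + 2 \<ge> 0"
    proof -
      have "(n + 1) * (n + 2) \<ge> 0"
        using False by (cases "n \<ge> -1") (auto intro: mult_nonneg_nonneg mult_nonpos_nonpos)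
      then show ?thesis by (simp add: algebra_simps)
    qed
    then have "t + n \<ge> - n - 1" using t by (simp add: algebra_simps)
    moreover have "n * (n + 1) \<ge> 0"
      using False by (cases "n = 0") (auto intro: mult_nonpos_nonpos)
    then have "t + n \<ge> 0" using t by (simp add: algebra_simps)
    then have "int s * (t + n) \<ge> 1 * (t + n)" using s by (intro mult_right_mono) auto
    moreover have "int i * n \<ge> int s * n"
      using False ij by (intro mult_right_mono_neg) auto
    ultimately show ?thesis using False \<open>t + n \<ge> 0\<close> by (simp add: algebra_simps)
  qed
  then show "int (theta_exp n) = int s * (n * (n - 1) div 2) + int i * n"
    "\<bar>n\<bar> \<le> int (theta_exp n) + 1"
    unfolding theta_exp_def by (simp_all add: t)
qed

lemma finite_theta_exp: "finite {n. theta_exp n \<le> d}"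
proof (rule finite_subset)
  show "{n. theta_exp n \<le> d} \<subseteq> {- int d - 1..int d + 1}"
    using theta_exp_ge by (auto simp: abs_le_iff) (smt (verit) of_nat_le_iff)+
qed simp

lemma theta_exp_Suc: "int (theta_exp (n + 1)) = int (theta_exp n) + int s * n + int i"
proof -
  obtain t where t: "n * (n - 1) = 2 * t"
    by (rule evenE[of "n * (n - 1)"]) auto
  have "(n + 1) * (n + 1 - 1) = 2 * (t + n)" using t by (simp add: algebra_simps)
  then show ?thesis unfolding theta_exp_int t by (simp add: algebra_simps)
qed

definition theta_term :: "int \<Rightarrow> 'a fps" where
  "theta_term n = fps_const ((- a) powi n) * fps_X ^ theta_exp n"

abbreviation (input) "U \<equiv> fps_const a * fps_X ^ i"
abbreviation (input) "V \<equiv> fps_const (inverse a) * fps_X ^ j"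
abbreviation (input) "Q \<equiv> (fps_X ^ s :: 'a fps)"

text \<open>The part \<open>Q ^ N * U\<close> of the next partial product moves the term n to n + 1.
  The power of \<open>Q\<close> left over is the one that the recurrence of the Gaussian binomials
  needs, and the hypothesis keeps its exponent from being truncated.\<close>

lemma theta_term_up:
  assumes "n \<le> int N"
  shows "Q ^ N * U * theta_term n = - (Q ^ nat (int N - n) * theta_term (n + 1))"
proof -
  have "int (s * N + i + theta_exp n) = int (s * nat (int N - n) + theta_exp (n + 1))"
    using assms theta_exp_Suc[of n] by (simp add: algebra_simps)
  then have "s * N + i + theta_exp n = s * nat (int N - n) + theta_exp (n + 1)"
    by (simp only: of_nat_eq_iff)
  then have X: "(fps_X::'a fps) ^ (s * N) * fps_X ^ i * fps_X ^ theta_exp n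
      = fps_X ^ (s * nat (int N - n)) * fps_X ^ theta_exp (n + 1)"
    by (simp only: power_add[symmetric])
  have "(- a) powi (n + 1) = - (a * (- a) powi n)"
    using a by (simp add: power_int_add)
  then have c: "fps_const ((- a) powi (n + 1)) = - (fps_const a * fps_const ((- a) powi n))"
    by simp
  have "Q ^ N * U * theta_term n = (fps_const a * fps_const ((- a) powi n)) *
      (fps_X ^ (s * N) * fps_X ^ i * fps_X ^ theta_exp n)"
    unfolding theta_term_def power_mult by (simp only: mult_ac)
  also have "\<dots> = (fps_const a * fps_const ((- a) powi n)) *
      (fps_X ^ (s * nat (int N - n)) * fps_X ^ theta_exp (n + 1))"
    by (simp only: X)
  also have "\<dots> = - (Q ^ nat (int N - n) * theta_term (n + 1))"
    unfolding theta_term_def c power_mult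
    by (simp only: mult_ac mult_minus_left mult_minus_right minus_minus)
  finally show ?thesis .
qed

lemma theta_term_down:
  assumes "- int N \<le> n"
  shows "Q ^ N * V * theta_term n = - (Q ^ nat (int N + n) * theta_term (n - 1))"
proof -
  have ij': "int i + int j = int s" using ij by simp
  have "int (s * N + j + theta_exp n) = int (s * nat (int N + n) + theta_exp (n - 1))"
    using assms theta_exp_Suc[of "n - 1"] ij' by (simp add: algebra_simps)
  then have "s * N + j + theta_exp n = s * nat (int N + n) + theta_exp (n - 1)"
    by (simp only: of_nat_eq_iff)
  then have X: "(fps_X::'a fps) ^ (s * N) * fps_X ^ j * fps_X ^ theta_exp n
      = fps_X ^ (s * nat (int N + n)) * fps_X ^ theta_exp (n - 1)"
    by (simp only: power_add[symmetric])
  have "(- a) powi (n - 1) = - (inverse a * (- a) powi n)"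
    using a by (simp add: power_int_diff field_simps)
  then have c: "fps_const ((- a) powi (n - 1)) = - (fps_const (inverse a) * fps_const ((- a) powi n))"
    by simp
  have "Q ^ N * V * theta_term n = (fps_const (inverse a) * fps_const ((- a) powi n)) *
      (fps_X ^ (s * N) * fps_X ^ j * fps_X ^ theta_exp n)"
    unfolding theta_term_def power_mult by (simp only: mult_ac)
  also have "\<dots> = (fps_const (inverse a) * fps_const ((- a) powi n)) *
      (fps_X ^ (s * nat (int N + n)) * fps_X ^ theta_exp (n - 1))"
    by (simp only: X)
  also have "\<dots> = - (Q ^ nat (int N + n) * theta_term (n - 1))"
    unfolding theta_term_def c power_mult
    by (simp only: mult_ac mult_minus_left mult_minus_right minus_minus)
  finally show ?thesis .
qed

section \<open>Gaussian binomial coefficients and the finite triple product\<close>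

definition qfact :: "nat \<Rightarrow> 'a fps" where
  "qfact n = qprod n Q Q"

lemma qfact_Suc: "qfact (Suc n) = qfact n * (1 - Q ^ Suc n)"
  by (simp add: qfact_def qprod_Suc)

lemma qfact_nth_0 [simp]: "qfact n $ 0 = 1"
  using s by (simp add: qfact_def)

text \<open>Setting \<open>1 / (q; q)\<^sub>k = 0\<close> for \<open>k < 0\<close> makes the recurrence below hold without
  boundary cases.\<close>

definition inv_qfact :: "int \<Rightarrow> 'a fps" where
  "inv_qfact k = (if k < 0 then 0 else inverse (qfact (nat k)))"

lemma inv_qfact_pred:
  assumes "k \<ge> 0"
  shows "inv_qfact (k - 1) = (1 - Q ^ nat k) * inv_qfact k"
proof (cases "k = 0")
  case False
  then have k: "nat k = Suc (nat (k - 1))" using assms by simp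
  have "(1 - Q ^ Suc (nat (k - 1))) * inverse (1 - Q ^ Suc (nat (k - 1))) = 1"
    by (rule inverse_mult_eq_1') (use s in \<open>simp flip: power_mult\<close>)
  then show ?thesis
    using assms False unfolding inv_qfact_def k qfact_Suc fps_inverse_mult
    by (simp add: mult_ac)
qed (simp add: inv_qfact_def)

text \<open>The Gaussian binomial coefficient of 2N over N + n in base \<open>Q\<close>, extended by
  0 to all integers n.\<close>

definition qbinom_mid :: "nat \<Rightarrow> int \<Rightarrow> 'a fps" where
  "qbinom_mid N n = qfact (2 * N) * inv_qfact (int N + n) * inv_qfact (int N - n)"

lemma qbinom_mid_eq_0: "\<bar>n\<bar> > int N \<Longrightarrow> qbinom_mid N n = 0"
  by (auto simp: qbinom_mid_def inv_qfact_def)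

text \<open>Passing from N to N + 1 raises the upper index by 2, so this is the q-Pascal rule
  applied twice. With k = N + 1 + n and l = N + 1 - n every term is a polynomial in \<open>Q\<close>
  times the same \<open>qfact (2 * N) * inv_qfact k * inv_qfact l\<close>, and only
  \<open>core\<close> has to be checked.\<close>

lemma qbinom_mid_rec:
  assumes "\<bar>n\<bar> \<le> int N + 1"
  shows "qbinom_mid (Suc N) n = (1 + Q ^ (2 * N + 1)) * qbinom_mid N n
    + Q ^ nat (int N - n + 1) * qbinom_mid N (n - 1) + Q ^ nat (int N + n + 1) * qbinom_mid N (n + 1)"
proof -
  define k l where "k = nat (int N + 1 + n)" and "l = nat (int N + 1 - n)"
  have kl: "int k = int N + 1 + n" "int l = int N + 1 - n" "k + l = 2 * N + 2"
    using assms by (auto simp: k_def l_def)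
  let ?al = "inv_qfact (int k)" and ?be = "inv_qfact (int l)"
  have pred: "inv_qfact (int m - 1) = (1 - Q ^ m) * inv_qfact (int m)" for m
    using inv_qfact_pred[of "int m"] by simp
  have pred2: "inv_qfact (int m - 2) = (1 - Q ^ (m - 1)) * (1 - Q ^ m) * inv_qfact (int m)" for m
  proof (cases m)
    case 0
    then show ?thesis by (simp add: inv_qfact_def)
  next
    case (Suc m')
    then show ?thesis using pred[of m] pred[of m'] by (simp add: mult_ac)
  qed
  have "qfact (2 * Suc N) = qfact (2 * N) * ((1 - Q ^ (2 * N + 1)) * (1 - Q ^ (2 * N + 2)))"
    by (simp add: qfact_Suc mult_ac)
  then have lhs: "qbinom_mid (Suc N) n
      = qfact (2 * N) * ((1 - Q ^ (2 * N + 1)) * (1 - Q ^ (2 * N + 2))) * ?al * ?be"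
    unfolding qbinom_mid_def by (simp add: kl add.commute)
  have m0: "qbinom_mid N n = qfact (2 * N) * ((1 - Q ^ k) * ?al) * ((1 - Q ^ l) * ?be)"
    unfolding qbinom_mid_def pred[symmetric] by (simp add: kl)
  have mm: "qbinom_mid N (n - 1) = qfact (2 * N) * ((1 - Q ^ (k - 1)) * (1 - Q ^ k) * ?al) * ?be"
    unfolding qbinom_mid_def pred2[symmetric] by (simp add: kl algebra_simps)
  have mp: "qbinom_mid N (n + 1) = qfact (2 * N) * ?al * ((1 - Q ^ (l - 1)) * (1 - Q ^ l) * ?be)"
    unfolding qbinom_mid_def pred2[symmetric] by (simp add: kl algebra_simps)
  have e: "nat (int N - n + 1) = l" "nat (int N + n + 1) = k"
    by (simp_all add: k_def l_def algebra_simps)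
  have core: "(1 - Q ^ (2 * N + 1)) * (1 - Q ^ (2 * N + 2))
     = (1 + Q ^ (2 * N + 1)) * (1 - Q ^ k) * (1 - Q ^ l)
      + Q ^ l * ((1 - Q ^ (k - 1)) * (1 - Q ^ k)) + Q ^ k * ((1 - Q ^ (l - 1)) * (1 - Q ^ l))"
  \<comment> \<open>At the ends k - 1 or l - 1 is a truncated difference, but the term that contains
    it has a vanishing factor 1 - Q^0.\<close>
  proof (cases "k = 0 \<or> l = 0")
    case True
    then have "k = 0 \<and> l = 2 * N + 2 \<or> l = 0 \<and> k = 2 * N + 2" using kl by auto
    then show ?thesis by auto
  next
    case False
    then obtain k' l' where "k = Suc k'" "l = Suc l'" by (metis not0_implies_Suc)
    moreover from this have "2 * N = k' + l'" using kl by simp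
    ultimately show ?thesis
      using qbinom_pascal_aux[of "Q ^ k'" "Q ^ l'" Q] by (simp add: power_add mult_ac)
  qed
  show ?thesis
    unfolding lhs m0 mm mp e core by (simp only: algebra_simps)
qed

text \<open>Because U V = Q, the two new factors multiply to 1 + Q^(2N+1) - Q^N U - Q^N V. The last
  two summands shift the index of \<open>theta_term\<close> by one up or down, and the three sums
  recombine by \<open>qbinom_mid_rec\<close>.\<close>

lemma finite_jacobi_triple:
  "qprod N U Q * qprod N V Q = (\<Sum>n\<in>{- int N..int N}. qbinom_mid N n * theta_term n)"
proof (induction N)
  case 0
  show ?case
    by (simp add: theta_term_def theta_exp_def qbinom_mid_def inv_qfact_def qfact_def)
next
  case (Suc N)
  let ?I = "{- int (Suc N)..int (Suc N)}"
  let ?b = "qbinom_mid N" and ?t = theta_term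
  have UV: "U * V = Q"
    using a ij by (simp add: fps_const_mult[symmetric] power_add[symmetric] mult_ac del: fps_const_mult)
       (metis fps_const_1_eq_1 fps_const_mult left_inverse mult.left_commute mult.right_neutral power_add)
  have ext: "(\<Sum>n\<in>{- int N..int N}. ?b n * f n) = (\<Sum>n\<in>?I. ?b n * f n)" for f
    by (intro sum.mono_neutral_left) (auto simp: qbinom_mid_eq_0)
  have up: "(\<Sum>n\<in>{- int N..int N}. ?b n * (Q ^ N * U * ?t n))
      = - (\<Sum>n\<in>?I. Q ^ nat (int N - n + 1) * ?b (n - 1) * ?t n)"
  proof -
    have "(\<Sum>n\<in>{- int N..int N}. ?b n * (Q ^ N * U * ?t n))
      = (\<Sum>n\<in>{- int N..int N}. - (Q ^ nat (int N - n) * ?b n * ?t (n + 1)))"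
      by (intro sum.cong refl, subst theta_term_up) (simp_all add: mult_ac)
    also have "\<dots> = (\<Sum>n\<in>{- int N + 1..int N + 1}. - (Q ^ nat (int N - n + 1) * ?b (n - 1) * ?t n))"
      by (intro sum.reindex_bij_witness[of _ "\<lambda>n. n - 1" "\<lambda>n. n + 1"]) (auto simp: algebra_simps)
    also have "\<dots> = (\<Sum>n\<in>?I. - (Q ^ nat (int N - n + 1) * ?b (n - 1) * ?t n))"
      by (intro sum.mono_neutral_left) (auto simp: qbinom_mid_eq_0)
    finally show ?thesis by (simp only: sum_negf)
  qed
  have down: "(\<Sum>n\<in>{- int N..int N}. ?b n * (Q ^ N * V * ?t n))
      = - (\<Sum>n\<in>?I. Q ^ nat (int N + n + 1) * ?b (n + 1) * ?t n)"
  proof -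
    have "(\<Sum>n\<in>{- int N..int N}. ?b n * (Q ^ N * V * ?t n))
      = (\<Sum>n\<in>{- int N..int N}. - (Q ^ nat (int N + n) * ?b n * ?t (n - 1)))"
      by (intro sum.cong refl, subst theta_term_down) (simp_all add: mult_ac)
    also have "\<dots> = (\<Sum>n\<in>{- int N - 1..int N - 1}. - (Q ^ nat (int N + n + 1) * ?b (n + 1) * ?t n))"
      by (intro sum.reindex_bij_witness[of _ "\<lambda>n. n + 1" "\<lambda>n. n - 1"]) (auto simp: algebra_simps)
    also have "\<dots> = (\<Sum>n\<in>?I. - (Q ^ nat (int N + n + 1) * ?b (n + 1) * ?t n))"
      by (intro sum.mono_neutral_left) (auto simp: qbinom_mid_eq_0)
    finally show ?thesis by (simp only: sum_negf)
  qed
  have QQ: "U * Q ^ N * (V * Q ^ N) = Q ^ (2 * N + 1)"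
  proof -
    have "U * Q ^ N * (V * Q ^ N) = (U * V) * (Q ^ N * Q ^ N)" by (simp only: mult_ac)
    then show ?thesis unfolding UV by (simp flip: power_add power_Suc add: mult_2)
  qed
  have expand: "(1 - x) * (1 - y) = 1 - x - y + x * y" for x y :: "'a fps"
    by (simp add: algebra_simps)
  have "(1 - U * Q ^ N) * (1 - V * Q ^ N) = 1 - U * Q ^ N - V * Q ^ N + U * Q ^ N * (V * Q ^ N)"
    by (rule expand)
  then have fac: "(1 - U * Q ^ N) * (1 - V * Q ^ N) = (1 + Q ^ (2 * N + 1)) - Q ^ N * U - Q ^ N * V"
    unfolding QQ by (simp add: mult_ac)
  have dist: "(\<Sum>n\<in>I. ?b n * ?t n) * x = (\<Sum>n\<in>I. ?b n * (x * ?t n))" for x I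
    unfolding sum_distrib_right by (intro sum.cong refl) (simp only: mult_ac)
  have "qprod (Suc N) U Q * qprod (Suc N) V Q
      = (qprod N U Q * qprod N V Q) * ((1 - U * Q ^ N) * (1 - V * Q ^ N))"
    by (simp only: qprod_Suc mult_ac)
  also have "\<dots> = (\<Sum>n\<in>{- int N..int N}. ?b n * ((1 + Q ^ (2 * N + 1)) * ?t n))
      - (\<Sum>n\<in>{- int N..int N}. ?b n * (Q ^ N * U * ?t n))
      - (\<Sum>n\<in>{- int N..int N}. ?b n * (Q ^ N * V * ?t n))"
    unfolding Suc.IH fac by (simp only: right_diff_distrib dist)
  also have "\<dots> = (\<Sum>n\<in>?I. qbinom_mid (Suc N) n * ?t n)"
    unfolding up down ext diff_minus_eq_add sum.distrib[symmetric]
    by (intro sum.cong refl, subst qbinom_mid_rec) (auto simp: algebra_simps)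
  finally show ?case .
qed

text \<open>After multiplication by (Q; Q)_N the coefficient of each fixed term tends to L L / (L L)
  = 1, where L is the limit of (Q; Q)_N. A given power of X sees only the finitely many n with small
  exponent, so the termwise limit suffices.\<close>

lemma jacobi_triple_tendsto:
  "(\<lambda>N. qprod N U Q * qprod N V Q * qprod N Q Q)
     \<longlonglongrightarrow> fibre_sum (\<lambda>n. (- a) powi n) theta_exp"
proof -
  \<comment> \<open>\<open>qpoch\<close> is defined over the complex numbers only; over a general
    field the limit is built from the stable coefficients.\<close>
  define L where "L = Abs_fps (\<lambda>d. qfact (Suc d) $ d)"
  have stable: "qfact N $ d = L $ d" if "d < N" for N d
  proof -
    have "Suc d \<le> N" using that by simp
    then show ?thesis
    proof (induction N rule: dec_induct)
      case base
      show ?case by (simp add: L_def)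
    next
      case (step M)
      have "Suc d \<le> M" using step.hyps by simp
      have "d < Suc M" using \<open>Suc d \<le> M\<close> by simp
      also have "Suc M \<le> s * Suc M" using s by (cases s) auto
      finally have "d < s * Suc M" .
      then have "qfact (Suc M) $ d = qfact M $ d"
        unfolding qfact_Suc
        by (simp add: right_diff_distrib fps_X_power_mult_right_nth flip: power_mult del: power_Suc mult_Suc_right)
      then show ?case using step.IH by simp
    qed
  qed
  have lim: "qfact \<longlonglongrightarrow> L"
  proof (rule tendsto_fpsI)
    show "\<forall>\<^sub>F N in sequentially. qfact N $ d = L $ d" for d
      unfolding eventually_sequentially by (intro exI[of _ "Suc d"]) (auto intro!: stable)
  qed
  have L0: "L $ 0 = 1" by (simp add: L_def)
  have inv: "(\<lambda>N. inv_qfact (int N + n)) \<longlonglongrightarrow> inverse L" for n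
  proof (rule Lim_transform_eventually)
    have "filterlim (\<lambda>N. nat (int N + n)) sequentially sequentially"
      unfolding filterlim_at_top eventually_sequentially
    proof
      fix Z
      show "\<exists>M. \<forall>N\<ge>M. Z \<le> nat (int N + n)"
        by (rule exI[of _ "Z + nat \<bar>n\<bar>"]) auto
    qed
    then have "(\<lambda>N. qfact (nat (int N + n))) \<longlonglongrightarrow> L"
      by (rule filterlim_compose[OF lim])
    then show "(\<lambda>N. inverse (qfact (nat (int N + n)))) \<longlonglongrightarrow> inverse L"
      by (rule tendsto_inverse_fps) (simp add: L0)
    show "\<forall>\<^sub>F N in sequentially. inverse (qfact (nat (int N + n))) = inv_qfact (int N + n)"
      unfolding eventually_sequentially inv_qfact_def by (intro exI[of _ "nat \<bar>n\<bar>"]) auto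
  qed
  define c where "c N n = qfact N * qbinom_mid N n" for N n
  have c_lim: "(\<lambda>N. c N n) \<longlonglongrightarrow> 1" for n
  proof -
    have "(\<lambda>N. qfact (2 * N)) \<longlonglongrightarrow> L"
      by (rule filterlim_compose[OF lim]) (simp add: filterlim_subseq strict_mono_def)
    then have "(\<lambda>N. c N n) \<longlonglongrightarrow> L * (L * inverse L * inverse L)"
      unfolding c_def qbinom_mid_def
      using inv[of n] inv[of "- n"] by (intro tendsto_mult_fps lim) simp_all
    moreover have "L * inverse L = 1" by (rule inverse_mult_eq_1') (simp add: L0)
    then have "L * (L * inverse L * inverse L) = 1" by simp
    ultimately show ?thesis by simp
  qed
  have prod_eq: "qprod N U Q * qprod N V Q * qprod N Q Q
      = (\<Sum>n\<in>{- int N..int N}. c N n * theta_term n)" for N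
    unfolding finite_jacobi_triple c_def qfact_def[symmetric]
    by (simp add: sum_distrib_left sum_distrib_right mult_ac)
  show ?thesis
  proof (rule tendsto_fpsI)
    fix d
    let ?J = "{n. theta_exp n \<le> d}"
    have "\<forall>\<^sub>F N in sequentially. (c N n * theta_term n) $ d = theta_term n $ d" for n
      using tendsto_mult_fps[OF c_lim tendsto_const[of "theta_term n"]]
      by (simp add: tendsto_fps_iff)
    then have "\<forall>\<^sub>F N in sequentially. \<forall>n\<in>?J. (c N n * theta_term n) $ d = theta_term n $ d"
      by (intro eventually_ball_finite finite_theta_exp) blast
    then show "\<forall>\<^sub>F N in sequentially. (qprod N U Q * qprod N V Q * qprod N Q Q) $ d
        = fibre_sum (\<lambda>n. (- a) powi n) theta_exp $ d"
      using eventually_ge_at_top[of "Suc d"]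
    proof eventually_elim
      case (elim N)
      have J: "?J \<subseteq> {- int N..int N}"
      proof
        fix n assume "n \<in> ?J"
        then show "n \<in> {- int N..int N}" using theta_exp_ge[of n] elim(2) by auto
      qed
      have "(qprod N U Q * qprod N V Q * qprod N Q Q) $ d
          = (\<Sum>n\<in>{- int N..int N}. (c N n * theta_term n) $ d)"
        by (simp add: prod_eq fps_sum_nth)
      also have "\<dots> = (\<Sum>n\<in>?J. (c N n * theta_term n) $ d)"
      proof (intro sum.mono_neutral_right J ballI)
        fix n assume n: "n \<in> {- int N..int N} - ?J"
        have eq: "c N n * theta_term n = c N n * fps_const ((- a) powi n) * fps_X ^ theta_exp n"
          by (simp add: theta_term_def mult_ac)
        show "(c N n * theta_term n) $ d = 0"
          unfolding eq fps_X_power_mult_right_nth using n by simp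
      qed simp
      also have "\<dots> = (\<Sum>n\<in>?J. theta_term n $ d)"
        using elim by (intro sum.cong) auto
      also have "\<dots> = (\<Sum>n | theta_exp n = d. (- a) powi n)"
        by (intro sum.mono_neutral_cong_right finite_theta_exp)
          (auto simp: theta_term_def fps_X_power_mult_right_nth)
      finally show ?case by (simp add: fibre_sum_def)
    qed
  qed
qed

end

section \<open>The crank generating function\<close>

definition partitions_of :: "nat \<Rightarrow> nat multiset set" where
  "partitions_of n = {p. is_partition p \<and> sum_mset p = n}"

definition bounded_partitions :: "nat \<Rightarrow> nat \<Rightarrow> nat multiset set" where
  "bounded_partitions N n = {p \<in> partitions_of n. \<forall>x\<in>#p. x \<le> N}"

lemma finite_partitions_of: "finite (partitions_of n)"
proof (rule finite_subset)
  show "partitions_of n \<subseteq> hd ` colored_partitions 1 n"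
    by (auto simp: partitions_of_def colored_partitions_def image_iff intro!: exI[of _ "[_]"])
qed (simp add: finite_colored_partitions)

text \<open>Either no part equals N + 1, or one such part is removed. The remainder may contain N +
  1 again, hence the bound \<open>Suc N\<close> on the right as well.\<close>

lemma bounded_partitions_Suc:
  "bounded_partitions (Suc N) n = bounded_partitions N n \<union>
     (if n < Suc N then {} else add_mset (Suc N) ` bounded_partitions (Suc N) (n - Suc N))"
  (is "?L = ?R")
proof (intro equalityI subsetI)
  fix p assume p: "p \<in> ?L"
  show "p \<in> ?R"
  proof (cases "Suc N \<in># p")
    case True
    then obtain p' where p': "p = add_mset (Suc N) p'" by (metis insert_DiffM)
    then have "p' \<in> bounded_partitions (Suc N) (n - Suc N)" "\<not> n < Suc N"
      using p by (auto simp: bounded_partitions_def partitions_of_def is_partition_def)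
    then show ?thesis using p' by auto
  next
    case False
    then have "\<forall>x\<in>#p. x \<le> N"
      using p by (auto simp: bounded_partitions_def) (metis le_SucE)
    then show ?thesis using p by (auto simp: bounded_partitions_def)
  qed
qed (auto simp: bounded_partitions_def partitions_of_def is_partition_def split: if_splits)

definition part_gf :: "'a::comm_ring_1 \<Rightarrow> 'a fps" where
  "part_gf z = Abs_fps (\<lambda>n. \<Sum>p\<in>partitions_of n. z ^ size p)"

definition bounded_part_gf :: "nat \<Rightarrow> 'a::comm_ring_1 \<Rightarrow> 'a fps" where
  "bounded_part_gf N z = Abs_fps (\<lambda>n. \<Sum>p\<in>bounded_partitions N n. z ^ size p)"

lemma bounded_part_gf_Suc:
  "(1 - fps_const z * fps_X ^ Suc N) * bounded_part_gf (Suc N) z = bounded_part_gf N z"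
proof (rule fps_ext)
  fix n
  let ?g = "\<lambda>N n. \<Sum>p\<in>bounded_partitions N n. z ^ size p"
  have "?g (Suc N) n = ?g N n + (if n < Suc N then 0 else z * ?g (Suc N) (n - Suc N))"
  proof (cases "n < Suc N")
    case False
    have "?g (Suc N) n = ?g N n + (\<Sum>p\<in>add_mset (Suc N) ` bounded_partitions (Suc N) (n - Suc N). z ^ size p)"
      using False by (subst bounded_partitions_Suc)
        (auto simp: bounded_partitions_def finite_partitions_of intro!: sum.union_disjoint)
    also have "(\<Sum>p\<in>add_mset (Suc N) ` bounded_partitions (Suc N) (n - Suc N). z ^ size p)
        = z * ?g (Suc N) (n - Suc N)"
      by (subst sum.reindex) (auto simp: sum_distrib_left inj_on_def)
    finally show ?thesis using False by simp
  qed (subst bounded_partitions_Suc, simp)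
  then show "((1 - fps_const z * fps_X ^ Suc N) * bounded_part_gf (Suc N) z) $ n = bounded_part_gf N z $ n"
    by (simp add: bounded_part_gf_def left_diff_distrib mult.assoc fps_X_power_mult_nth del: power_Suc)
qed

lemma bounded_part_gf_0: "bounded_part_gf 0 z = 1"
proof -
  have "p = {#}" if "is_partition p" "\<forall>x\<in>#p. x = 0" for p
    using that by (cases p) (auto simp: is_partition_def)
  then have sub: "bounded_partitions 0 n \<subseteq> {{#}}" for n
    by (auto simp: bounded_partitions_def partitions_of_def)
  have mem: "{#} \<in> bounded_partitions 0 n \<longleftrightarrow> n = 0" for n
    by (auto simp: bounded_partitions_def partitions_of_def is_partition_def)
  have "bounded_partitions 0 n = (if n = 0 then {{#}} else {})" for n
    using sub[of n] mem[of n] by (auto simp: subset_singleton_iff)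
  then show ?thesis by (simp add: bounded_part_gf_def fps_eq_iff)
qed

lemma bounded_part_gf_qprod: "bounded_part_gf N z * qprod N (fps_const z * fps_X) fps_X = 1"
proof (induction N)
  case (Suc N)
  have "bounded_part_gf (Suc N) z * qprod (Suc N) (fps_const z * fps_X) fps_X
      = (1 - fps_const z * fps_X ^ Suc N) * bounded_part_gf (Suc N) z * qprod N (fps_const z * fps_X) fps_X"
    by (simp add: qprod_Suc mult_ac)
  then show ?case by (simp only: bounded_part_gf_Suc Suc.IH)
qed (simp add: bounded_part_gf_0)

lemma bounded_part_gf_tendsto: "(\<lambda>N. bounded_part_gf N z) \<longlonglongrightarrow> part_gf z"
proof (rule tendsto_fpsI)
  fix n
  have "bounded_partitions N n = partitions_of n" if "n \<le> N" for N
  proof -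
    have "x \<le> sum_mset p" if "x \<in># p" for x and p :: "nat multiset"
      using that by (metis sum_mset.remove le_add1)
    then show ?thesis using that by (fastforce simp: bounded_partitions_def partitions_of_def)
  qed
  then show "\<forall>\<^sub>F N in sequentially. bounded_part_gf N z $ n = part_gf z $ n"
    unfolding eventually_sequentially bounded_part_gf_def part_gf_def
    by (intro exI[of _ n]) simp
qed

lemma colored_partitions_0: "colored_partitions 0 n = (if n = 0 then {[]} else {})"
  by (auto simp: colored_partitions_def)

text \<open>Every colour has its own variable, and the Cauchy product splits off the first colour.
  The crank corresponds to the list z, 1/z, 1, 1.\<close>

lemma colored_partitions_gf:
  "(\<Sum>\<pi>\<in>colored_partitions (length zs) n. \<Prod>(z, p)\<leftarrow>zip zs \<pi>. z ^ size p)
     = (\<Prod>z\<leftarrow>zs. part_gf z) $ n"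
proof (induction zs arbitrary: n)
  case Nil
  then show ?case by (simp add: colored_partitions_0)
next
  case (Cons z zs)
  let ?w = "\<lambda>zs \<pi>. \<Prod>(z, p)\<leftarrow>zip zs \<pi>. z ^ size p"
  let ?D = "SIGMA i:{0..n}. partitions_of i \<times> colored_partitions (length zs) (n - i)"
  have "(\<Prod>z\<leftarrow>z # zs. part_gf z) $ n
      = (\<Sum>i=0..n. (\<Sum>p\<in>partitions_of i. z ^ size p)
          * (\<Sum>\<pi>\<in>colored_partitions (length zs) (n - i). ?w zs \<pi>))"
    by (simp add: fps_mult_nth Cons.IH part_gf_def)
  also have "\<dots> = (\<Sum>i=0..n. \<Sum>(p, \<pi>)\<in>partitions_of i \<times> colored_partitions (length zs) (n - i).
      z ^ size p * ?w zs \<pi>)"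
    by (simp add: sum_product sum.cartesian_product)
  also have "\<dots> = (\<Sum>(i, p, \<pi>)\<in>?D. z ^ size p * ?w zs \<pi>)"
    by (subst sum.Sigma) (auto simp: finite_partitions_of finite_colored_partitions)
  also have "\<dots> = (\<Sum>\<pi>\<in>colored_partitions (length (z # zs)) n. ?w (z # zs) \<pi>)"
    by (rule sum.reindex_bij_witness[where i = "\<lambda>\<pi>. (sum_mset (hd \<pi>), hd \<pi>, tl \<pi>)"
          and j = "\<lambda>(i, p, \<pi>). p # \<pi>"])
      (auto simp: colored_partitions_def partitions_of_def length_Suc_conv)
  finally show ?case ..
qed

definition crank_gf :: "complex \<Rightarrow> complex fps" where
  "crank_gf z = Abs_fps (\<lambda>n. \<Sum>\<pi>\<in>colored_partitions 4 n. z powi crank \<pi>)"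

lemma crank_gf_eq:
  assumes "z \<noteq> 0"
  shows "crank_gf z = part_gf z * part_gf (inverse z) * part_gf 1 ^ 2"
proof (rule fps_ext)
  fix n
  have "crank_gf z $ n = (\<Sum>\<pi>\<in>colored_partitions (length [z, inverse z, 1, 1]) n.
      \<Prod>(z, p)\<leftarrow>zip [z, inverse z, 1, 1] \<pi>. z ^ size p)"
    unfolding crank_gf_def fps_nth_Abs_fps
  proof (rule sum.cong)
    fix \<pi> assume "\<pi> \<in> colored_partitions (length [z, inverse z, 1, 1]) n"
    then have "length \<pi> = Suc (Suc (Suc (Suc 0)))" by (simp add: colored_partitions_def)
    then obtain a b c d where "\<pi> = [a, b, c, d]" by (auto simp: length_Suc_conv)
    then show "z powi crank \<pi> = (\<Prod>(z, p)\<leftarrow>zip [z, inverse z, 1, 1] \<pi>. z ^ size p)"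
      using assms by (simp add: crank_def power_int_diff field_simps)
  qed (simp add: eval_nat_numeral)
  then show "crank_gf z $ n = (part_gf z * part_gf (inverse z) * part_gf 1 ^ 2) $ n"
    unfolding colored_partitions_gf by (simp add: power2_eq_square mult_ac)
qed

section \<open>The theta series in the crank variable\<close>

definition tri :: "int \<Rightarrow> nat" where
  "tri n = nat (n * (n + 1) div 2)"

definition theta :: "complex \<Rightarrow> complex fps" where
  "theta z = fibre_sum (\<lambda>n. (- z) powi n) tri"

definition euler :: "complex fps" where
  "euler = qpoch fps_X fps_X"

lemma qprod_tendsto_euler: "(\<lambda>N. qprod N fps_X fps_X) \<longlonglongrightarrow> euler"
  using qprod_tendsto_qpoch[of 1 1] by (simp add: euler_def)

lemma part_gf_1: "part_gf 1 * euler = 1"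
proof (rule LIMSEQ_unique)
  show "(\<lambda>N. bounded_part_gf N 1 * qprod N fps_X fps_X) \<longlonglongrightarrow> part_gf 1 * euler"
    by (intro tendsto_mult_fps bounded_part_gf_tendsto qprod_tendsto_euler)
  show "(\<lambda>N. bounded_part_gf N 1 * qprod N fps_X fps_X) \<longlonglongrightarrow> (1 :: complex fps)"
    using bounded_part_gf_qprod[of _ "1 :: complex"] by simp
qed

lemma jacobi_triple_tri: "jacobi_triple.theta_exp (Suc 0) (Suc 0) = tri"
proof
  fix n :: int
  obtain t where "n * (n - 1) = 2 * t"
    by (rule evenE[of "n * (n - 1)"]) auto
  moreover from this have "n * (n + 1) = 2 * (t + n)" by (simp add: algebra_simps)
  moreover have "jacobi_triple 1 0 1 (1 :: complex)" by unfold_locales auto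
  ultimately show "jacobi_triple.theta_exp (Suc 0) (Suc 0) n = tri n"
    by (simp add: jacobi_triple.theta_exp_def tri_def)
qed

lemma finite_tri: "finite {n. tri n \<le> d}"
proof -
  interpret jacobi_triple 1 0 1 "1 :: complex" by unfold_locales auto
  show ?thesis using finite_theta_exp by (simp add: jacobi_triple_tri)
qed

text \<open>The triple product with arguments z X and 1/z, that is j = 0. The second product starts
  with the factor 1 - 1/z; all later factors cancel against
  \<open>part_gf (inverse z)\<close>.\<close>

lemma part_gf_theta:
  assumes "z \<noteq> 0"
  shows "part_gf z * part_gf (inverse z) * theta z = fps_const (1 - inverse z) * euler"
proof -
  interpret jacobi_triple 1 0 1 z by unfold_locales (use assms in auto)
  let ?u = "fps_const z * fps_X :: complex fps" and ?v = "fps_const (inverse z) :: complex fps"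
  \<comment> \<open>The bounds differ by one: with 1 - 1/z split off, only N factors of the second
    product remain to be cancelled.\<close>
  let ?b = "\<lambda>N. bounded_part_gf (Suc N) z * bounded_part_gf N (inverse z)"
  have lim: "(\<lambda>N. qprod N ?u fps_X * qprod N ?v fps_X * qprod N fps_X fps_X) \<longlonglongrightarrow> theta z"
    using jacobi_triple_tendsto by (simp add: theta_def jacobi_triple_tri)
  have "(\<lambda>N. ?b N * (qprod (Suc N) ?u fps_X * qprod (Suc N) ?v fps_X * qprod (Suc N) fps_X fps_X))
      \<longlonglongrightarrow> part_gf z * part_gf (inverse z) * theta z"
    by (intro tendsto_mult_fps bounded_part_gf_tendsto LIMSEQ_Suc[OF bounded_part_gf_tendsto]
        LIMSEQ_Suc[OF lim])
  moreover have "?b N * (qprod (Suc N) ?u fps_X * qprod (Suc N) ?v fps_X * qprod (Suc N) fps_X fps_X)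
      = (1 - ?v) * qprod (Suc N) fps_X fps_X" for N
  proof -
    have "?b N * (qprod (Suc N) ?u fps_X * qprod (Suc N) ?v fps_X * qprod (Suc N) fps_X fps_X)
      = (bounded_part_gf (Suc N) z * qprod (Suc N) ?u fps_X)
        * (bounded_part_gf N (inverse z) * qprod N (?v * fps_X) fps_X)
        * ((1 - ?v) * qprod (Suc N) fps_X fps_X)"
      unfolding qprod_Suc_shift[of N ?v] by (simp only: mult_ac)
    then show ?thesis by (simp only: bounded_part_gf_qprod mult_1)
  qed
  ultimately have "(\<lambda>N. (1 - ?v) * qprod (Suc N) fps_X fps_X)
      \<longlonglongrightarrow> part_gf z * part_gf (inverse z) * theta z" by simp
  moreover have "(\<lambda>N. (1 - ?v) * qprod (Suc N) fps_X fps_X) \<longlonglongrightarrow> (1 - ?v) * euler"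
    by (intro tendsto_mult_fps tendsto_const LIMSEQ_Suc[OF qprod_tendsto_euler])
  ultimately have "part_gf z * part_gf (inverse z) * theta z = (1 - ?v) * euler"
    by (rule LIMSEQ_unique)
  then show ?thesis by (simp flip: fps_const_1_eq_1)
qed

lemma crank_gf_theta:
  assumes "z \<noteq> 0"
  shows "crank_gf z * euler * theta z = fps_const (1 - inverse z)"
proof -
  have "crank_gf z * euler * theta z
      = (part_gf z * part_gf (inverse z) * theta z) * (part_gf 1 * euler) * part_gf 1"
    unfolding crank_gf_eq[OF assms] by (simp add: power2_eq_square mult_ac)
  also have "\<dots> = fps_const (1 - inverse z) * (part_gf 1 * euler) * (part_gf 1 * euler)"
    unfolding part_gf_theta[OF assms] by (simp only: mult_ac)
  finally show ?thesis by (simp only: part_gf_1 mult_1_right)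
qed

section \<open>Differentiation in the crank variable\<close>

lemma fps_mult_has_field_derivative:
  fixes f g :: "complex \<Rightarrow> complex fps"
  assumes "\<And>n. ((\<lambda>w. f w $ n) has_field_derivative f' $ n) (at z)"
    and "\<And>n. ((\<lambda>w. g w $ n) has_field_derivative g' $ n) (at z)"
  shows "((\<lambda>w. (f w * g w) $ n) has_field_derivative (f' * g z + f z * g') $ n) (at z)"
proof -
  have "((\<lambda>w. \<Sum>i=0..n. f w $ i * g w $ (n - i)) has_field_derivative
      (\<Sum>i=0..n. f' $ i * g z $ (n - i) + f z $ i * g' $ (n - i))) (at z)"
    by (auto intro!: derivative_eq_intros assms sum.cong)
  then show ?thesis by (simp add: fps_mult_nth sum.distrib)
qed

definition crank_gf_deriv :: "complex \<Rightarrow> complex fps" where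
  "crank_gf_deriv z = Abs_fps (\<lambda>n. \<Sum>\<pi>\<in>colored_partitions 4 n. of_int (crank \<pi>) * z powi crank \<pi>)"

definition theta_deriv :: "complex \<Rightarrow> complex fps" where
  "theta_deriv z = fibre_sum (\<lambda>n. of_int n * (- z) powi n) tri"

text \<open>The operator z d/dz applied to \<open>crank_gf_theta\<close>. Each coefficient is a
  finite Laurent sum in z, so the derivative can be taken coefficientwise; \<open>?c\<close> is the
  factor 1/z between the ordinary derivative and z d/dz.\<close>

lemma crank_gf_theta_deriv:
  assumes "z \<noteq> 0"
  shows "crank_gf_deriv z * euler * theta z + crank_gf z * euler * theta_deriv z = fps_const (inverse z)"
proof -
  let ?c = "fps_const (inverse z)"
  have C: "((\<lambda>w. (crank_gf w * euler) $ n) has_field_derivative (?c * crank_gf_deriv z * euler) $ n) (at z)" for n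
  proof -
    have "((\<lambda>w. crank_gf w $ n) has_field_derivative (?c * crank_gf_deriv z) $ n) (at z)" for n
      unfolding crank_gf_def crank_gf_deriv_def
      using assms by (auto intro!: derivative_eq_intros sum.cong
          simp: sum_distrib_left power_int_diff divide_inverse mult_ac)
    from fps_mult_has_field_derivative[OF this, of "\<lambda>w. euler" 0]
    show ?thesis by simp
  qed
  have T: "((\<lambda>w. theta w $ n) has_field_derivative (?c * theta_deriv z) $ n) (at z)" for n
  proof -
    have "((\<lambda>w. (- w) powi n) has_field_derivative inverse z * (of_int n * (- z) powi n)) (at z)" for n
      by (cases "even n")
        (use assms in \<open>auto simp: power_int_minus_left power_int_diff field_simps intro!: derivative_eq_intros\<close>)
    then show ?thesis
      unfolding theta_def theta_deriv_def fibre_sum_def fps_mult_left_const_nth fps_nth_Abs_fps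
        sum_distrib_left by (rule DERIV_sum)
  qed
  have "(?c * crank_gf_deriv z * euler * theta z + crank_gf z * euler * (?c * theta_deriv z)) $ n
      = fps_const (inverse z ^ 2) $ n" for n
  proof (rule DERIV_unique)
    show "((\<lambda>w. (crank_gf w * euler * theta w) $ n) has_field_derivative
      (?c * crank_gf_deriv z * euler * theta z + crank_gf z * euler * (?c * theta_deriv z)) $ n) (at z)"
      by (rule fps_mult_has_field_derivative[OF C T])
    have "((\<lambda>w. fps_const (1 - inverse w) $ n) has_field_derivative fps_const (inverse z ^ 2) $ n) (at z)"
      using assms by (cases n) (auto intro!: derivative_eq_intros simp: power2_eq_square)
    \<comment> \<open>\<open>crank_gf_theta\<close> requires a nonzero argument, so the two
      functions are compared on the open set of nonzero numbers.\<close>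
    then show "((\<lambda>w. (crank_gf w * euler * theta w) $ n) has_field_derivative
        fps_const (inverse z ^ 2) $ n) (at z)"
      by (rule has_field_derivative_transform_within_open[of _ _ _ "- {0}"])
        (use assms in \<open>auto simp: crank_gf_theta\<close>)
  qed
  then have "?c * (crank_gf_deriv z * euler * theta z + crank_gf z * euler * theta_deriv z)
      = ?c * ?c"
    by (simp add: fps_eq_iff power2_eq_square algebra_simps)
  moreover have "?c \<noteq> 0" using assms by simp
  ultimately show ?thesis by (simp only: mult_cancel_left) simp
qed

text \<open>Multiplying the derivative relation by \<open>theta z\<close> lets
  \<open>crank_gf_theta\<close> eliminate \<open>crank_gf z\<close>, at the price of a square of
  \<open>theta z\<close>.\<close>

lemma crank_gf_deriv_eq:
  assumes "z \<noteq> 0"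
  shows "crank_gf_deriv z * euler * theta z ^ 2
    = fps_const (inverse z) * theta z - fps_const (1 - inverse z) * theta_deriv z"
proof -
  have "crank_gf_deriv z * euler * theta z ^ 2
      = (crank_gf_deriv z * euler * theta z + crank_gf z * euler * theta_deriv z) * theta z
        - (crank_gf z * euler * theta z) * theta_deriv z"
    by (simp add: algebra_simps power2_eq_square)
  then show ?thesis
    by (simp only: crank_gf_theta_deriv[OF assms] crank_gf_theta[OF assms])
qed

text \<open>At z = 1 the factor \<open>crank_gf 1 * euler\<close> is the inverse of
  \<open>euler ^ 3\<close>. The product relation then forces \<open>theta 1\<close> to vanish, and
  the derivative relation becomes Jacobi's identity.\<close>

lemma theta_1: "theta 1 = 0"
  and theta_deriv_1: "theta_deriv 1 = euler ^ 3"
proof -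
  have "crank_gf 1 * euler ^ 4 = (part_gf 1 * euler) ^ 4"
    by (simp add: crank_gf_eq power_mult_distrib) (simp add: eval_nat_numeral mult_ac)
  moreover have "crank_gf 1 * euler ^ 4 = crank_gf 1 * euler * euler ^ 3"
    by (simp add: eval_nat_numeral mult_ac)
  ultimately have 1: "crank_gf 1 * euler * euler ^ 3 = 1"
    by (simp only: part_gf_1 power_one)
  then have nz: "crank_gf 1 * euler \<noteq> 0" by auto
  have "crank_gf 1 * euler * theta 1 = 0" using crank_gf_theta[of 1] by simp
  then show "theta 1 = 0" using nz by simp
  then have "crank_gf 1 * euler * theta_deriv 1 = crank_gf 1 * euler * euler ^ 3"
    using crank_gf_theta_deriv[of 1] 1 by simp
  then show "theta_deriv 1 = euler ^ 3" using nz by (simp only: mult_cancel_left) simp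
qed

section \<open>From the weighted count to fifth roots of unity\<close>

lemma sum_colored_partitions_swap:
  "(\<Sum>\<pi>\<in>colored_partitions 4 n. f (size (\<pi> ! 0)) (size (\<pi> ! 1)))
     = (\<Sum>\<pi>\<in>colored_partitions 4 n. f (size (\<pi> ! 1)) (size (\<pi> ! 0)))"
proof -
  let ?s = "\<lambda>\<pi> :: nat multiset list. \<pi> ! 1 # \<pi> ! 0 # drop 2 \<pi>"
  have four: "\<exists>a b c d. \<pi> = [a, b, c, d]" if "\<pi> \<in> colored_partitions 4 n" for \<pi>
    using that by (auto simp: colored_partitions_def eval_nat_numeral length_Suc_conv)
  show ?thesis
    by (rule sum.reindex_bij_witness[where i = ?s and j = ?s])
      (frule four, elim exE, simp add: colored_partitions_def add_ac)+
qed

definition crank_weight :: "int \<Rightarrow> complex" where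
  "crank_weight m = (if m mod 5 = 1 then 1 else if m mod 5 = 2 then 2 else
     if m mod 5 = 3 then - 2 else if m mod 5 = 4 then - 1 else 0)"

definition weighted_gf :: "complex fps" where
  "weighted_gf = Abs_fps (\<lambda>n. \<Sum>\<pi>\<in>colored_partitions 4 n. crank_weight (crank \<pi>) * of_nat (size (\<pi> ! 0)))"

lemma F_series_nth: "F_series r $ n = weighted_gf $ (5 * n + r)"
proof -
  let ?N = "5 * n + r"
  have NB: "of_nat (NB 4 m 5 ?N) = (\<Sum>\<pi>\<in>colored_partitions 4 ?N.
      (if crank \<pi> mod 5 = int m then 1 else 0) * of_nat (size (\<pi> ! 0)) :: complex)" if "m < 5" for m
  proof -
    have "(of_nat (NB 4 m 5 ?N) :: complex)
      = (\<Sum>\<pi> \<in> {\<pi> \<in> colored_partitions 4 ?N. crank \<pi> mod 5 = int m}. of_nat (size (\<pi> ! 0)))"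
      using that by (simp add: NB_def cong_def)
    then show ?thesis
      by (simp add: sum.inter_filter[OF finite_colored_partitions]) (auto intro: sum.cong)
  qed
  have "F_series r $ n = of_nat (NB 4 1 5 ?N) - of_nat (NB 4 4 5 ?N)
       + 2 * of_nat (NB 4 2 5 ?N) - 2 * of_nat (NB 4 3 5 ?N)"
    by (simp add: F_series_def)
  also have "\<dots> = weighted_gf $ ?N"
    unfolding weighted_gf_def fps_nth_Abs_fps
    by (simp add: NB sum_distrib_left flip: sum_subtractf sum.distrib)
      (auto intro!: sum.cong simp: crank_weight_def)
  finally show ?thesis .
qed

lemma crank_weight_minus: "crank_weight (- m) = - crank_weight m"
proof -
  have "m mod 5 \<in> {0, 1, 2, 3, 4}" by auto
  then show ?thesis
    unfolding crank_weight_def by (auto simp: zmod_zminus1_eq_if)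
qed

text \<open>Primitivity is stated by the cyclotomic polynomial, which is the form that
  \<open>algebra\<close> can use.\<close>

locale fifth_root =
  fixes \<zeta> :: complex
  assumes sum_powers: "\<zeta> ^ 4 + \<zeta> ^ 3 + \<zeta> ^ 2 + \<zeta> + 1 = 0"
begin

lemma power5: "\<zeta> ^ 5 = 1"
proof -
  have "\<zeta> ^ 5 - 1 = (\<zeta> - 1) * (\<zeta> ^ 4 + \<zeta> ^ 3 + \<zeta> ^ 2 + \<zeta> + 1)"
    by (simp add: algebra_simps eval_nat_numeral)
  then show ?thesis by (simp add: sum_powers)
qed

lemma nonzero: "\<zeta> \<noteq> 0"
  using power5 by auto

lemma inverse_eq: "inverse \<zeta> = \<zeta> ^ 4"
  using power5 nonzero by (simp add: field_simps eval_nat_numeral)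

lemma powi_mod: "\<zeta> powi n = \<zeta> ^ nat (n mod 5)"
proof -
  have "\<zeta> powi n = \<zeta> powi (5 * (n div 5) + n mod 5)" by simp
  also have "\<dots> = (\<zeta> powi 5) powi (n div 5) * \<zeta> powi (n mod 5)"
    unfolding power_int_mult[symmetric] by (rule power_int_add) (simp add: nonzero)
  also have "\<dots> = \<zeta> ^ nat (n mod 5)"
    by (simp add: power5 power_int_def)
  finally show ?thesis .
qed

text \<open>The Fourier coefficients of \<open>crank_weight\<close> at \<open>\<zeta>\<close> and \<open>\<zeta>\<^sup>2\<close>; those at the inverses
  are their negatives.\<close>

definition c1 :: complex where "c1 = - (\<zeta> - \<zeta> ^ 4 + 2 * (\<zeta> ^ 2 - \<zeta> ^ 3)) / 5"
definition c2 :: complex where "c2 = (2 * (\<zeta> - \<zeta> ^ 4) - (\<zeta> ^ 2 - \<zeta> ^ 3)) / 5"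

text \<open>Both sides are odd and of period 5 in m, so the values 1 and 2 at m = 1, 2 decide. With
  a = \<zeta> - \<zeta>^4 and b = \<zeta>^2 - \<zeta>^3 these are the equations c1 a + c2 b = 1 and
  c1 b - c2 a = 2, of determinant -(a^2 + b^2) = 5, which explains the denominators of
  \<open>c1\<close> and \<open>c2\<close>.\<close>

lemma crank_weight_eq:
  "crank_weight m = c1 * (\<zeta> powi m - \<zeta> powi (- m)) + c2 * ((\<zeta> ^ 2) powi m - (\<zeta> ^ 2) powi (- m))"
proof -
  have p2: "(\<zeta> ^ 2) powi k = (\<zeta> powi k) ^ 2" for k
    by (metis power_int_mult power_int_numeral mult.commute power_int_of_nat of_nat_numeral)
  have pow: "\<zeta> ^ 6 = \<zeta>" "\<zeta> ^ 8 = \<zeta> ^ 3"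
    using power_add[of \<zeta> 5 1] power_add[of \<zeta> 5 3] by (simp_all add: power5)
  have "(\<zeta> - \<zeta> ^ 4) ^ 2 + (\<zeta> ^ 2 - \<zeta> ^ 3) ^ 2
      = \<zeta> ^ 8 + \<zeta> ^ 6 + \<zeta> ^ 4 + \<zeta> ^ 2 - 4 * \<zeta> ^ 5"
    by (simp add: eval_nat_numeral algebra_simps)
  also have "\<dots> = - 5"
    using sum_powers by (simp add: pow power5 add_eq_0_iff algebra_simps)
  finally have sq: "(\<zeta> - \<zeta> ^ 4) ^ 2 + (\<zeta> ^ 2 - \<zeta> ^ 3) ^ 2 = - 5" .
  have w1: "c1 * (\<zeta> - \<zeta> ^ 4) + c2 * (\<zeta> ^ 2 - \<zeta> ^ 3) = 1"
    and w2: "c1 * (\<zeta> ^ 2 - \<zeta> ^ 3) - c2 * (\<zeta> - \<zeta> ^ 4) = 2"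
  proof -
    have "- (a + 2 * b) / 5 * a + (2 * a - b) / 5 * b = - (a ^ 2 + b ^ 2) / 5"
      "- (a + 2 * b) / 5 * b - (2 * a - b) / 5 * a = - 2 * (a ^ 2 + b ^ 2) / 5" for a b :: complex
      by (simp_all add: field_simps power2_eq_square)
    then show "c1 * (\<zeta> - \<zeta> ^ 4) + c2 * (\<zeta> ^ 2 - \<zeta> ^ 3) = 1"
      "c1 * (\<zeta> ^ 2 - \<zeta> ^ 3) - c2 * (\<zeta> - \<zeta> ^ 4) = 2"
      unfolding c1_def c2_def by (simp_all only: sq) simp_all
  qed
  have "m mod 5 \<in> {0, 1, 2, 3, 4}" by auto
  then show ?thesis
    unfolding p2 powi_mod[of m] powi_mod[of "- m"] zmod_zminus1_eq_if crank_weight_def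
    using w1 w2 by (auto simp: pow algebra_simps simp flip: power_mult)
      (simp_all add: power2_eq_square algebra_simps)
qed

text \<open>Since the weight is odd, averaging over the exchange of the first two colours replaces
  the number of parts of the first colour by half the crank. Both sides are doubled to avoid the
  halves.\<close>

lemma weighted_gf_eq: "weighted_gf = fps_const c1 * crank_gf_deriv \<zeta> + fps_const c2 * crank_gf_deriv (\<zeta> ^ 2)"
proof (rule fps_ext)
  fix n
  let ?S = "\<lambda>f :: nat \<Rightarrow> nat \<Rightarrow> complex. \<Sum>\<pi>\<in>colored_partitions 4 n. f (size (\<pi> ! 0)) (size (\<pi> ! 1))"
  have swap: "2 * ?S f = ?S (\<lambda>a b. f a b + f b a)" for f
    using sum_colored_partitions_swap[of f n] by (simp add: sum.distrib)
  have D: "2 * crank_gf_deriv z $ n = ?S (\<lambda>a b. of_int (int a - int b) *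
      (z powi (int a - int b) - z powi (int b - int a)))" for z
  proof -
    have "2 * crank_gf_deriv z $ n = 2 * ?S (\<lambda>a b. of_int (int a - int b) * z powi (int a - int b))"
      by (simp add: crank_gf_deriv_def crank_def)
    also have "\<dots> = ?S (\<lambda>a b. of_int (int a - int b) *
      (z powi (int a - int b) - z powi (int b - int a)))"
      unfolding swap[of "\<lambda>a b. of_int (int a - int b) * z powi (int a - int b)"]
      by (intro sum.cong refl) (simp add: algebra_simps)
    finally show ?thesis .
  qed
  have "2 * weighted_gf $ n = 2 * ?S (\<lambda>a b. crank_weight (int a - int b) * of_nat a)"
    by (simp add: weighted_gf_def crank_def)
  also have "\<dots> = ?S (\<lambda>a b. crank_weight (int a - int b) * of_int (int a - int b))"
    unfolding swap[of "\<lambda>a b. crank_weight (int a - int b) * of_nat a"]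
  proof (intro sum.cong refl)
    show "crank_weight (int a - int b) * of_nat a + crank_weight (int b - int a) * of_nat b
        = crank_weight (int a - int b) * of_int (int a - int b)" for a b
      using crank_weight_minus[of "int a - int b"] by (simp add: algebra_simps)
  qed
  also have "\<dots> = c1 * (2 * crank_gf_deriv \<zeta> $ n) + c2 * (2 * crank_gf_deriv (\<zeta> ^ 2) $ n)"
    unfolding D sum_distrib_left sum.distrib[symmetric] crank_weight_eq
    by (intro sum.cong refl) (simp add: algebra_simps)
  also have "\<dots> = 2 * (fps_const c1 * crank_gf_deriv \<zeta> + fps_const c2 * crank_gf_deriv (\<zeta> ^ 2)) $ n"
    by (simp add: algebra_simps)
  finally show "weighted_gf $ n = (fps_const c1 * crank_gf_deriv \<zeta> + fps_const c2 * crank_gf_deriv (\<zeta> ^ 2)) $ n"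
    by (simp only: mult_cancel_left) simp
qed

end

lemma ex_fifth_root: "\<exists>\<zeta>. fifth_root \<zeta>"
proof -
  have "card {z :: complex. z ^ 5 = 1} = 5"
    by (rule card_nth_roots) auto
  then have "\<not> {z :: complex. z ^ 5 = 1} \<subseteq> {1}"
    by (auto dest: subset_singletonD)
  then obtain z :: complex where z: "z ^ 5 = 1" "z \<noteq> 1" by auto
  have "(z - 1) * (z ^ 4 + z ^ 3 + z ^ 2 + z + 1) = z ^ 5 - 1"
    by (simp add: algebra_simps eval_nat_numeral)
  then show ?thesis using z unfolding fifth_root_def by auto
qed

section \<open>Dissection modulo 5\<close>

abbreviation dilate :: "complex fps \<Rightarrow> complex fps" where
  "dilate f \<equiv> f oo fps_X ^ 5"

lemma dilate_mult: "dilate (f * g) = dilate f * dilate g"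
  and dilate_power: "dilate (f ^ k) = dilate f ^ k"
  and dilate_X: "dilate fps_X = fps_X ^ 5"
  and dilate_const: "dilate (fps_const c) = fps_const c"
  and dilate_numeral: "dilate (numeral w) = numeral w"
  by (simp_all add: fps_compose_mult_distrib fps_compose_power flip: numeral_fps_const)

definition exp1 :: "int \<Rightarrow> nat" where "exp1 n = nat (n * (5 * n + 1) div 2)"
definition exp3 :: "int \<Rightarrow> nat" where "exp3 n = nat (n * (5 * n + 3) div 2)"

text \<open>\<open>PA\<close>, \<open>PB\<close>, \<open>P5\<close> are the $A$, $B$, $E_5$ of the theorem.\<close>

definition PA :: "complex fps" where "PA = qpochs [fps_X, fps_X ^ 4] (fps_X ^ 5)"
definition PB :: "complex fps" where "PB = qpochs [fps_X ^ 2, fps_X ^ 3] (fps_X ^ 5)"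
definition P5 :: "complex fps" where "P5 = qpoch (fps_X ^ 5) (fps_X ^ 5)"

text \<open>The two list entries are ordered so that (i, j) = (4, 1) and (3, 2) match the
  definitions of \<open>PA\<close> and \<open>PB\<close> literally.\<close>

lemma jacobi_triple_product_5:
  assumes "i + j = 5" "i > 0" "j > 0"
  shows "qpochs [fps_X ^ j, fps_X ^ i] (fps_X ^ 5) * P5
    = fibre_sum (\<lambda>n. (- 1) powi n) (\<lambda>n. nat (n * (5 * n + (2 * int i - 5)) div 2))"
    and "finite {n. nat (n * (5 * n + (2 * int i - 5)) div 2) \<le> d}"
proof -
  interpret jacobi_triple i j 5 "1 :: complex" by unfold_locales (use assms in auto)
  have e: "theta_exp n = nat (n * (5 * n + (2 * int i - 5)) div 2)" for n
  proof -
    obtain t where "n * (n - 1) = 2 * t"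
      by (rule evenE[of "n * (n - 1)"]) auto
    moreover from this have "n * (5 * n + (2 * int i - 5)) = 2 * (5 * t + int i * n)"
      by (simp add: algebra_simps)
    ultimately show ?thesis by (simp add: theta_exp_def)
  qed
  show "finite {n. nat (n * (5 * n + (2 * int i - 5)) div 2) \<le> d}"
    using finite_theta_exp by (simp add: e)
  show "qpochs [fps_X ^ j, fps_X ^ i] (fps_X ^ 5) * P5
    = fibre_sum (\<lambda>n. (- 1) powi n) (\<lambda>n. nat (n * (5 * n + (2 * int i - 5)) div 2))"
  proof (rule LIMSEQ_unique)
    show "(\<lambda>N. qprod N (fps_X ^ i) (fps_X ^ 5 :: complex fps) * qprod N (fps_X ^ j) (fps_X ^ 5) * qprod N (fps_X ^ 5) (fps_X ^ 5))
      \<longlonglongrightarrow> qpochs [fps_X ^ j, fps_X ^ i] (fps_X ^ 5) * P5"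
      using assms by (simp add: qpochs_def P5_def mult.commute[of "qpoch (fps_X ^ j) _"])
        (intro tendsto_mult_fps qprod_tendsto_qpoch, auto)
    show "(\<lambda>N. qprod N (fps_X ^ i) (fps_X ^ 5 :: complex fps) * qprod N (fps_X ^ j) (fps_X ^ 5) * qprod N (fps_X ^ 5) (fps_X ^ 5))
      \<longlonglongrightarrow> fibre_sum (\<lambda>n. (- 1) powi n) (\<lambda>n. nat (n * (5 * n + (2 * int i - 5)) div 2))"
      using jacobi_triple_tendsto by (simp add: e[abs_def])
  qed
qed

lemma PB_P5: "PB * P5 = fibre_sum (\<lambda>n. (- 1) powi n) exp1"
  and finite_exp1: "finite {n. exp1 n \<le> d}"
  using jacobi_triple_product_5[of 3 2] by (simp_all add: PB_def exp1_def[abs_def])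

lemma PA_P5: "PA * P5 = fibre_sum (\<lambda>n. (- 1) powi n) exp3"
  using jacobi_triple_product_5[of 4 1] by (simp_all add: PA_def exp3_def[abs_def])

text \<open>The reflection n to -n - 1 fixes \<open>tri\<close>. It pairs the residue 0 of n with 4
  and 1 with 3, and it maps 2 to itself, where \<open>tri\<close> reproduces itself at q^25. The
  coefficients stay arbitrary so that \<open>theta\<close> and \<open>theta_deriv\<close> can share
  the dissection.\<close>

lemma tri_dissection:
  "fibre_sum c tri = dilate (fibre_sum (\<lambda>m. c (5 * m) + c (- 5 * m - 1)) exp1)
     + fps_X * dilate (fibre_sum (\<lambda>m. c (5 * m + 1) + c (- 5 * m - 2)) exp3)
     + fps_X ^ 3 * dilate (dilate (fibre_sum (\<lambda>m. c (5 * m + 2)) tri))"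
proof -
  let ?F = "\<lambda>r. fibre_sum (\<lambda>m. c (5 * m + r)) (\<lambda>m. tri (5 * m + r))"
  have bij: "bij (\<lambda>m::int. - m - 1)"
    by (rule bij_betw_byWitness[where f' = "\<lambda>m. - m - 1"]) auto
  have F: "fibre_sum c tri = ?F 0 + ?F 1 + ?F 2 + ?F 3 + ?F 4"
    using fibre_sum_split_mod[OF finite_tri, of 5 c] by (simp add: lessThan_Suc eval_nat_numeral algebra_simps)
  have F3: "?F 3 = fibre_sum (\<lambda>m. c (- 5 * m - 2)) (\<lambda>m. tri (5 * m + 1))"
  proof -
    have arg: "5 * (- m - 1) + 3 = - 5 * m - 2" for m :: int by simp
    have e: "tri (- 5 * m - 2) = tri (5 * m + 1)" for m by (simp add: tri_def algebra_simps)
    have "?F 3 = fibre_sum (\<lambda>m. c (5 * (- m - 1) + 3)) (\<lambda>m. tri (5 * (- m - 1) + 3))"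
      by (rule fibre_sum_reindex[OF bij, of "\<lambda>m. c (5 * m + 3)" "\<lambda>m. tri (5 * m + 3)", symmetric])
    then show ?thesis by (simp only: arg e)
  qed
  have F4: "?F 4 = fibre_sum (\<lambda>m. c (- 5 * m - 1)) (\<lambda>m. tri (5 * m))"
  proof -
    have arg: "5 * (- m - 1) + 4 = - 5 * m - 1" for m :: int by simp
    have e: "tri (- 5 * m - 1) = tri (5 * m)" for m by (simp add: tri_def algebra_simps)
    have "?F 4 = fibre_sum (\<lambda>m. c (5 * (- m - 1) + 4)) (\<lambda>m. tri (5 * (- m - 1) + 4))"
      by (rule fibre_sum_reindex[OF bij, of "\<lambda>m. c (5 * m + 4)" "\<lambda>m. tri (5 * m + 4)", symmetric])
    then show ?thesis by (simp only: arg e)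
  qed
  have t0: "tri (5 * m) = 5 * exp1 m" for m
  proof -
    obtain t where t: "m * (5 * m + 1) = 2 * t"
      by (rule evenE[of "m * (5 * m + 1)"]) auto
    then have "(5 * m) * (5 * m + 1) = 2 * (5 * t)" by (simp add: algebra_simps)
    moreover have "t \<ge> 0"
      using t zero_le_mult_iff[of m] by (smt (verit))
    ultimately show ?thesis using t by (simp add: tri_def exp1_def nat_add_distrib nat_mult_distrib)
  qed
  have t1: "tri (5 * m + 1) = 5 * exp3 m + 1" for m
  proof -
    obtain t where t: "m * (5 * m + 3) = 2 * t"
      by (rule evenE[of "m * (5 * m + 3)"]) auto
    then have "(5 * m + 1) * (5 * m + 1 + 1) = 2 * (5 * t + 1)" by (simp add: algebra_simps)
    moreover have "t \<ge> 0"
      using t zero_le_mult_iff[of m] by (smt (verit))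
    ultimately show ?thesis using t by (simp add: tri_def exp3_def nat_add_distrib nat_mult_distrib)
  qed
  have t2: "tri (5 * m + 2) = 25 * tri m + 3" for m
  proof -
    obtain t where t: "m * (m + 1) = 2 * t"
      by (rule evenE[of "m * (m + 1)"]) auto
    then have "(5 * m + 2) * (5 * m + 2 + 1) = 2 * (25 * t + 3)" by (simp add: algebra_simps)
    moreover have "t \<ge> 0"
      using t zero_le_mult_iff[of m] by (smt (verit))
    ultimately show ?thesis using t by (simp add: tri_def  nat_add_distrib nat_mult_distrib)
  qed
  have d1: "dilate (fibre_sum c' exp1) = fibre_sum c' (\<lambda>m. tri (5 * m))" for c'
    by (simp add: fibre_sum_compose_power t0)
  have d3: "fps_X * dilate (fibre_sum c' exp3) = fibre_sum c' (\<lambda>m. tri (5 * m + 1))" for c'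
    using fibre_sum_shift[of 1 c'] by (simp add: fibre_sum_compose_power t1)
  have d25: "fps_X ^ 3 * dilate (dilate (fibre_sum c' tri)) = fibre_sum c' (\<lambda>m. tri (5 * m + 2))" for c'
    by (simp add: fibre_sum_compose_power fibre_sum_shift t2)
  show ?thesis
    unfolding F F3 F4 d1 d3 d25 unfolding fibre_sum_add[symmetric] by (simp add: algebra_simps)
qed

lemma euler_eq: "euler = PA * PB * P5"
proof (rule LIMSEQ_unique)
  let ?q = "\<lambda>i N. qprod N (fps_X ^ i) (fps_X ^ 5 :: complex fps)"
  have split: "qprod (5 * N) fps_X fps_X = (?q 1 N * ?q 4 N) * (?q 2 N * ?q 3 N) * ?q 5 N" for N
  proof (induction N)
    case (Suc N)
    have step: "qprod (M + 5) a q = qprod M a q * (1 - a * q ^ M) * (1 - a * q ^ (M + 1))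
        * (1 - a * q ^ (M + 2)) * (1 - a * q ^ (M + 3)) * (1 - a * q ^ (M + 4))"
      for M and a q :: "complex fps"
      by (simp add: eval_nat_numeral qprod_Suc)
    have f: "fps_X * fps_X ^ (5 * N + k) = (fps_X :: complex fps) ^ Suc k * (fps_X ^ 5) ^ N" for k
      by (simp only: power_mult[symmetric] power_add[symmetric] power_Suc[symmetric] add_Suc add.commute)
    have "5 * Suc N = 5 * N + 5" by simp
    then have "qprod (5 * Suc N) fps_X fps_X = qprod (5 * N) fps_X fps_X *
      ((1 - fps_X ^ 1 * (fps_X ^ 5) ^ N) * (1 - fps_X ^ 2 * (fps_X ^ 5) ^ N)
       * (1 - fps_X ^ 3 * (fps_X ^ 5) ^ N) * (1 - fps_X ^ 4 * (fps_X ^ 5) ^ N)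
       * (1 - fps_X ^ 5 * (fps_X ^ 5) ^ N) :: complex fps)"
      unfolding step using f[of 0] f[of 1] f[of 2] f[of 3] f[of 4]
      by (simp only: step mult.assoc) (simp add: eval_nat_numeral)
    then show ?case unfolding Suc.IH qprod_Suc by (simp only: mult_ac)
  qed simp
  have "filterlim (\<lambda>N. 5 * N) sequentially sequentially"
    by (simp add: filterlim_subseq strict_mono_def)
  from filterlim_compose[OF qprod_tendsto_euler this]
  show "(\<lambda>N. qprod (5 * N) fps_X fps_X) \<longlonglongrightarrow> euler" .
  show "(\<lambda>N. qprod (5 * N) fps_X fps_X) \<longlonglongrightarrow> PA * PB * P5"
    unfolding split PA_def PB_def P5_def qpochs_def list.map prod_list.Cons prod_list.Nil mult_1_right
    using qprod_tendsto_qpoch[of 1 5]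
    by (intro tendsto_mult_fps qprod_tendsto_qpoch) auto
qed

lemma P5_eq: "P5 = dilate euler"
proof (rule LIMSEQ_unique)
  have "qprod N (fps_X ^ 5) (fps_X ^ 5) = dilate (qprod N fps_X fps_X)" for N
    by (induction N) (simp_all add: qprod_Suc dilate_mult dilate_power dilate_X fps_compose_sub_distrib)
  then show "(\<lambda>N. qprod N (fps_X ^ 5) (fps_X ^ 5)) \<longlonglongrightarrow> dilate euler"
    by (simp add: tendsto_compose_fps qprod_tendsto_euler)
qed (simp add: P5_def qprod_tendsto_qpoch)

section \<open>Theta series at fifth roots of unity\<close>

definition theta_moment1 :: "complex fps" where
  "theta_moment1 = fibre_sum (\<lambda>n. of_int n * (- 1) powi n) exp1"
definition theta_moment3 :: "complex fps" where
  "theta_moment3 = fibre_sum (\<lambda>n. of_int n * (- 1) powi n) exp3"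

lemma S_series_eq: "S_series fps_X = theta_moment1"
proof -
  have t: "(- 1) powi n * of_int n * fps_X ^ nat (n * (5 * n + 1) div 2)
      = fps_const (of_int n * (- 1) powi n :: complex) * fps_X ^ exp1 n" for n :: int
  proof -
    have "(- 1 :: complex fps) = fps_const (- 1)"
      by (simp only: fps_const_neg[symmetric] fps_const_1_eq_1)
    then have "(- 1 :: complex fps) powi n = fps_const ((- 1) powi n)"
      by (simp only: power_int_def) (simp add: fps_const_power fps_const_inverse)
    moreover have "(of_int n :: complex fps) = fps_const (of_int n)"
      by (simp add: fps_of_int)
    ultimately show ?thesis by (simp only: exp1_def fps_const_mult mult.commute)
  qed
  show ?thesis
    unfolding S_series_def theta_moment1_def t by (intro infsumI fibre_sum_has_sum finite_exp1)
qed

lemma powi_5: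
  assumes "z ^ 5 = (1 :: complex)"
  shows "(- z) powi (5 * m + int r) = (- 1) powi m * (- z) ^ r"
proof -
  have z: "z \<noteq> 0" using assms by auto
  have "(- z) powi (5 * m + int r) = ((- z) powi 5) powi m * (- z) powi int r"
    unfolding power_int_mult[symmetric] by (rule power_int_add) (simp add: z)
  also have "(- z) powi 5 = - 1" using assms by simp
  finally show ?thesis by simp
qed

lemma powi_5_values:
  assumes "z ^ 5 = (1 :: complex)"
  shows "(- z) powi (5 * m) = (- 1) powi m"
    "(- z) powi (5 * m + 1) = - z * (- 1) powi m"
    "(- z) powi (5 * m + 2) = z ^ 2 * (- 1) powi m"
    "(- z) powi (- 5 * m - 1) = - (z ^ 4) * (- 1) powi m"
    "(- z) powi (- 5 * m - 2) = z ^ 3 * (- 1) powi m"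
proof -
  have s: "(- 1 :: complex) powi (- m - 1) = - ((- 1) powi m)"
    by (simp add: power_int_diff power_int_minus field_simps flip: power_int_mult_distrib)
  have "- 5 * m - 1 = 5 * (- m - 1) + int 4" "- 5 * m - 2 = 5 * (- m - 1) + int 3" by simp_all
  then show "(- z) powi (- 5 * m - 1) = - (z ^ 4) * (- 1) powi m"
    "(- z) powi (- 5 * m - 2) = z ^ 3 * (- 1) powi m"
    by (simp_all only: powi_5[OF assms] s) simp_all
  show "(- z) powi (5 * m) = (- 1) powi m"
    "(- z) powi (5 * m + 1) = - z * (- 1) powi m"
    "(- z) powi (5 * m + 2) = z ^ 2 * (- 1) powi m"
    using powi_5[OF assms, of m 0] powi_5[OF assms, of m 1] powi_5[OF assms, of m 2] by simp_all
qed

text \<open>The self-similar class, n = 2 modulo 5, contributes a multiple of \<open>theta 1\<close>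
  at q^25, which is 0.\<close>

lemma theta_dissection:
  assumes "z ^ 5 = 1"
  shows "theta z = fps_const (1 - z ^ 4) * dilate (PB * P5) - fps_const (z - z ^ 3) * fps_X * dilate (PA * P5)"
proof -
  have 1: "fibre_sum (\<lambda>m. (- z) powi (5 * m) + (- z) powi (- 5 * m - 1)) exp1 = fps_const (1 - z ^ 4) * (PB * P5)"
    unfolding powi_5_values[OF assms] PB_P5 fibre_sum_cmult by (simp add: algebra_simps)
  have 3: "fibre_sum (\<lambda>m. (- z) powi (5 * m + 1) + (- z) powi (- 5 * m - 2)) exp3 = - (fps_const (z - z ^ 3) * (PA * P5))"
    unfolding powi_5_values[OF assms] PA_P5 fibre_sum_cmult fibre_sum_minus by (simp add: algebra_simps)
  have "fibre_sum (\<lambda>m. (- z) powi (5 * m + 2)) tri = fps_const (z ^ 2) * theta 1"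
    unfolding powi_5_values[OF assms] theta_def fibre_sum_cmult ..
  then have 25: "fibre_sum (\<lambda>m. (- z) powi (5 * m + 2)) tri = 0" by (simp add: theta_1)
  show ?thesis
    using tri_dissection[of "\<lambda>n. (- z) powi n"] unfolding 1 3 25 theta_def[symmetric]
    by (simp add: dilate_mult dilate_const fps_compose_uminus mult_ac)
qed

text \<open>The weight n = 5m + r splits every class into a moment and a plain theta series. In the
  class r = 2 the moment is Jacobi's cube at q^25 and the plain part vanishes.\<close>

lemma theta_deriv_dissection:
  assumes "z ^ 5 = 1"
  shows "theta_deriv z = dilate (fps_const (5 + 5 * z ^ 4) * theta_moment1 + fps_const (z ^ 4) * (PB * P5))
    - fps_X * dilate (fps_const (5 * z + 5 * z ^ 3) * theta_moment3 + fps_const (z + 2 * z ^ 3) * (PA * P5))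
    + fps_const (5 * z ^ 2) * fps_X ^ 3 * dilate P5 ^ 3"
proof -
  let ?c = "\<lambda>n. of_int n * (- z) powi n"
  have 1: "fibre_sum (\<lambda>m. ?c (5 * m) + ?c (- 5 * m - 1)) exp1
      = fps_const (5 + 5 * z ^ 4) * theta_moment1 + fps_const (z ^ 4) * (PB * P5)"
    unfolding powi_5_values[OF assms] PB_P5 theta_moment1_def fibre_sum_cmult fibre_sum_add
    by (simp add: algebra_simps)
  have 3: "fibre_sum (\<lambda>m. ?c (5 * m + 1) + ?c (- 5 * m - 2)) exp3
      = - (fps_const (5 * z + 5 * z ^ 3) * theta_moment3 + fps_const (z + 2 * z ^ 3) * (PA * P5))"
    unfolding powi_5_values[OF assms] PA_P5 theta_moment3_def fibre_sum_cmult fibre_sum_add fibre_sum_minus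
    by (simp add: algebra_simps)
  have "fibre_sum (\<lambda>m. ?c (5 * m + 2)) tri = fps_const (5 * z ^ 2) * theta_deriv 1 + fps_const (2 * z ^ 2) * theta 1"
    unfolding powi_5_values[OF assms] theta_def theta_deriv_def fibre_sum_cmult fibre_sum_add
    by (simp add: algebra_simps)
  then have 25: "fibre_sum (\<lambda>m. ?c (5 * m + 2)) tri = fps_const (5 * z ^ 2) * euler ^ 3"
    by (simp add: theta_1 theta_deriv_1)
  show ?thesis
    using tri_dissection[of ?c] unfolding 1 3 25 theta_deriv_def[symmetric]
    unfolding dilate_mult dilate_const dilate_power P5_eq[symmetric] fps_compose_uminus
    by (simp add: mult_ac)
qed

lemma euler_cube_dissection:
  "euler ^ 3 = dilate (10 * theta_moment1 + PB * P5) - fps_X * dilate (10 * theta_moment3 + 3 * (PA * P5))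
     + fps_X ^ 3 * dilate (5 * P5 ^ 3)"
  using theta_deriv_dissection[of 1]
  by (simp add: theta_deriv_1 dilate_mult dilate_power dilate_numeral fps_compose_add_distrib
      flip: numeral_fps_const)

text \<open>Conjugate factors are paired, so that only s = w + w^4 with s^2 = 1 - s is left.\<close>

lemma prod_fifth_roots:
  fixes w Y :: "'a::idom"
  assumes w: "w ^ 4 + w ^ 3 + w ^ 2 + w + 1 = 0"
  shows "(1 - Y) * (1 - w * Y) * (1 - w ^ 2 * Y) * (1 - w ^ 3 * Y) * (1 - w ^ 4 * Y) = 1 - Y ^ 5"
proof -
  define s where "s = w + w ^ 4"
  have "w ^ 5 - 1 = (w - 1) * (w ^ 4 + w ^ 3 + w ^ 2 + w + 1)"
    by (simp add: algebra_simps eval_nat_numeral)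
  then have w5: "w ^ 5 = 1" using w by simp
  have a: "(1 - w * Y) * (1 - w ^ 4 * Y) = 1 - (w + w ^ 4) * Y + w ^ 5 * Y ^ 2"
    "(1 - w ^ 2 * Y) * (1 - w ^ 3 * Y) = 1 - (w ^ 2 + w ^ 3) * Y + w ^ 5 * Y ^ 2"
    by (simp_all add: algebra_simps eval_nat_numeral)
  have s': "w ^ 2 + w ^ 3 = - 1 - s" using w unfolding s_def by algebra
  have "s ^ 2 = w ^ 2 + 2 * w ^ 5 + w ^ 5 * w ^ 3"
    by (simp add: s_def algebra_simps eval_nat_numeral)
  then have s2: "s ^ 2 = 1 - s" using s' unfolding w5 by algebra
  have "(1 - Y) * (1 - w * Y) * (1 - w ^ 2 * Y) * (1 - w ^ 3 * Y) * (1 - w ^ 4 * Y)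
      = (1 - Y) * ((1 - w * Y) * (1 - w ^ 4 * Y)) * ((1 - w ^ 2 * Y) * (1 - w ^ 3 * Y))"
    by (simp only: mult_ac)
  also have "\<dots> = (1 - Y) * (1 - s * Y + Y ^ 2) * (1 + (1 + s) * Y + Y ^ 2)"
    unfolding a s' w5 s_def[symmetric] by (simp add: algebra_simps)
  also have "\<dots> = 1 - Y ^ 5"
    using s2 by algebra
  finally show ?thesis .
qed

context fifth_root
begin

lemma fifth_root_powers: "fifth_root (\<zeta> ^ 2)" "fifth_root (\<zeta> ^ 3)" "fifth_root (\<zeta> ^ 4)"
proof -
  have red: "\<zeta> ^ (5 * a + b) = \<zeta> ^ b" for a b by (simp add: power_add power_mult power5)
  have "\<zeta> ^ 6 = \<zeta>" "\<zeta> ^ 8 = \<zeta> ^ 3" "\<zeta> ^ 9 = \<zeta> ^ 4" "\<zeta> ^ 12 = \<zeta> ^ 2" "\<zeta> ^ 16 = \<zeta>"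
    using red[of 1 1] red[of 1 3] red[of 1 4] red[of 2 2] red[of 3 1] by simp_all
  then show "fifth_root (\<zeta> ^ 2)" "fifth_root (\<zeta> ^ 3)" "fifth_root (\<zeta> ^ 4)"
    using sum_powers by (simp_all add: fifth_root_def add_ac flip: power_mult)
qed

abbreviation "w \<equiv> fps_const \<zeta> :: complex fps"

lemma w_sum: "w ^ 4 + w ^ 3 + w ^ 2 + w + 1 = 0"
  using arg_cong[OF sum_powers, of fps_const]
  by (simp only: fps_const_add[symmetric] fps_const_power[symmetric] fps_const_1_eq_1 fps_const_0_eq_0)

lemma prod_roots:
  "(1 - Y) * (1 - w * Y) * (1 - w ^ 2 * Y) * (1 - w ^ 3 * Y) * (1 - w ^ 4 * Y) = 1 - Y ^ 5"
  by (rule prod_fifth_roots[OF w_sum])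

end

definition dissect :: "(nat \<Rightarrow> complex fps) \<Rightarrow> complex fps" where
  "dissect f = (\<Sum>r<5. fps_X ^ r * dilate (f r))"

lemma dissect_nth:
  assumes "r < 5"
  shows "dissect f $ (5 * n + r) = f r $ n"
proof -
  have "(fps_X ^ k * dilate (f k)) $ (5 * n + r) = (if k = r then f r $ n else 0)" if "k < 5" for k
  proof (cases "5 * n + r < k")
    case True
    then show ?thesis using assms by (auto simp: fps_X_power_mult_nth)
  next
    case False
    then have "5 dvd 5 * n + r - k \<longleftrightarrow> k = r"
      using assms that by presburger
    then show ?thesis using False by (auto simp: fps_X_power_mult_nth fps_nth_compose_X_power)
  qed
  then have "dissect f $ (5 * n + r) = (\<Sum>k<5. if k = r then f r $ n else 0)"
    unfolding dissect_def fps_sum_nth by (intro sum.cong) auto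
  then show ?thesis using assms by simp
qed

lemma dissect_expand:
  "dissect f = dilate (f 0) + fps_X * dilate (f 1) + fps_X ^ 2 * dilate (f 2) + fps_X ^ 3 * dilate (f 3)
     + fps_X ^ 4 * dilate (f 4)"
  by (simp add: dissect_def eval_nat_numeral)

lemma dissect_eqD:
  assumes "dissect f = dissect g" "r < 5"
  shows "f r = g r"
  using assms dissect_nth[of r f] dissect_nth[of r g] by (auto simp: fps_eq_iff)

context fifth_root
begin

text \<open>The products (\<zeta>^k q; q) over all five k multiply to (q^5; q^5), factor by factor
  by \<open>prod_roots\<close>. The root 1 contributes \<open>part_gf 1\<close>, the inverse of
  \<open>euler\<close>.\<close>

lemma prod_part_gf:
  "part_gf \<zeta> * part_gf (\<zeta> ^ 2) * part_gf (\<zeta> ^ 3) * part_gf (\<zeta> ^ 4) * P5 = euler"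
proof -
  let ?Q = "\<lambda>z N. qprod N (fps_const z * fps_X) fps_X :: complex fps"
  let ?b = "\<lambda>z N. bounded_part_gf N z"
  have Q: "?Q 1 N * ?Q \<zeta> N * ?Q (\<zeta> ^ 2) N * ?Q (\<zeta> ^ 3) N * ?Q (\<zeta> ^ 4) N
      = qprod N (fps_X ^ 5) (fps_X ^ 5)" for N
  proof (induction N)
    case (Suc N)
    have "?Q 1 (Suc N) * ?Q \<zeta> (Suc N) * ?Q (\<zeta> ^ 2) (Suc N) * ?Q (\<zeta> ^ 3) (Suc N) * ?Q (\<zeta> ^ 4) (Suc N)
      = (?Q 1 N * ?Q \<zeta> N * ?Q (\<zeta> ^ 2) N * ?Q (\<zeta> ^ 3) N * ?Q (\<zeta> ^ 4) N) *
        ((1 - fps_X ^ Suc N) * (1 - w * fps_X ^ Suc N) * (1 - w ^ 2 * fps_X ^ Suc N)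
         * (1 - w ^ 3 * fps_X ^ Suc N) * (1 - w ^ 4 * fps_X ^ Suc N))"
      by (simp only: qprod_Suc fps_const_power power_Suc fps_const_1_eq_1 mult_1 mult_ac)
    also have "\<dots> = qprod N (fps_X ^ 5) (fps_X ^ 5) * (1 - (fps_X ^ Suc N) ^ 5)"
      by (simp only: Suc.IH prod_roots)
    also have "(fps_X ^ Suc N) ^ 5 = (fps_X :: complex fps) ^ 5 * (fps_X ^ 5) ^ N"
      by (simp only: power_mult[symmetric] power_add[symmetric] mult_Suc mult.commute[of _ 5] mult_Suc_right)
    finally show ?case by (simp add: qprod_Suc)
  qed simp
  have "?b 1 N * ?b \<zeta> N * ?b (\<zeta> ^ 2) N * ?b (\<zeta> ^ 3) N * ?b (\<zeta> ^ 4) N * qprod N (fps_X ^ 5) (fps_X ^ 5) = 1" for N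
  proof -
    have "?b 1 N * ?b \<zeta> N * ?b (\<zeta> ^ 2) N * ?b (\<zeta> ^ 3) N * ?b (\<zeta> ^ 4) N * qprod N (fps_X ^ 5) (fps_X ^ 5)
      = (?b 1 N * ?Q 1 N) * (?b \<zeta> N * ?Q \<zeta> N) * (?b (\<zeta> ^ 2) N * ?Q (\<zeta> ^ 2) N)
        * (?b (\<zeta> ^ 3) N * ?Q (\<zeta> ^ 3) N) * (?b (\<zeta> ^ 4) N * ?Q (\<zeta> ^ 4) N)"
      unfolding Q[symmetric] by (simp only: mult_ac)
    then show ?thesis by (simp only: bounded_part_gf_qprod mult_1)
  qed
  moreover have "(\<lambda>N. ?b 1 N * ?b \<zeta> N * ?b (\<zeta> ^ 2) N * ?b (\<zeta> ^ 3) N * ?b (\<zeta> ^ 4) N * qprod N (fps_X ^ 5) (fps_X ^ 5))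
      \<longlonglongrightarrow> part_gf 1 * part_gf \<zeta> * part_gf (\<zeta> ^ 2) * part_gf (\<zeta> ^ 3) * part_gf (\<zeta> ^ 4) * P5"
    unfolding P5_def by (intro tendsto_mult_fps bounded_part_gf_tendsto qprod_tendsto_qpoch) auto
  ultimately have "part_gf 1 * part_gf \<zeta> * part_gf (\<zeta> ^ 2) * part_gf (\<zeta> ^ 3) * part_gf (\<zeta> ^ 4) * P5 = 1"
    by (simp add: LIMSEQ_const_iff)
  then have "(part_gf 1 * euler) * (part_gf \<zeta> * part_gf (\<zeta> ^ 2) * part_gf (\<zeta> ^ 3) * part_gf (\<zeta> ^ 4) * P5) = euler"
    by (simp add: mult_ac)
  then show ?thesis by (simp only: part_gf_1 mult_1)
qed

end

section \<open>The relations between $A$, $B$ and the Euler products\<close>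

text \<open>If g and h are the roots of X^2 = X + 1, then f u = (x - g u y) (x - h u y), so the
  product is (x^5 - g^5 y^5) (x^5 - h^5 y^5). Here g h = -1, and 11 = g^5 + h^5 is a Lucas number.
  The proof avoids g and h by pairing conjugate values of u.\<close>

lemma prod_norm_form:
  fixes w x y :: "'a::idom"
  assumes w: "w ^ 4 + w ^ 3 + w ^ 2 + w + 1 = 0"
  defines "f \<equiv> \<lambda>u. x ^ 2 - u * x * y - u ^ 2 * y ^ 2"
  shows "f 1 * f w * f (w ^ 2) * f (w ^ 3) * f (w ^ 4) = x ^ 10 - 11 * x ^ 5 * y ^ 5 - y ^ 10"
proof -
  define s where "s = w + w ^ 4"
  have "w ^ 5 - 1 = (w - 1) * (w ^ 4 + w ^ 3 + w ^ 2 + w + 1)"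
    by (simp add: algebra_simps eval_nat_numeral)
  then have w5: "w ^ 5 = 1" using w by simp
  have red: "w ^ (5 * a + b) = w ^ b" for a b by (simp add: power_add power_mult w5)
  have wp: "w ^ 6 = w" "w ^ 7 = w ^ 2" "w ^ 8 = w ^ 3" "w ^ 9 = w ^ 4" "w ^ 10 = 1"
    using red[of 1 1] red[of 1 2] red[of 1 3] red[of 1 4] red[of 2 0] by simp_all
  have s': "w ^ 2 + w ^ 3 = - 1 - s" using w unfolding s_def by algebra
  have "s ^ 2 = w ^ 2 + 2 * w ^ 5 + w ^ 8"
    by (simp add: s_def algebra_simps eval_nat_numeral)
  then have s2: "s ^ 2 = 1 - s" using s' unfolding w5 wp by algebra
  have "f w * f (w ^ 4) = x ^ 4 - (w + w ^ 4) * x ^ 3 * y - (w ^ 2 + w ^ 8) * x ^ 2 * y ^ 2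
      + w ^ 5 * x ^ 2 * y ^ 2 + (w ^ 9 + w ^ 6) * x * y ^ 3 + w ^ 10 * y ^ 4"
    by (simp add: f_def algebra_simps eval_nat_numeral)
  also have "\<dots> = x ^ 4 - s * x ^ 3 * y + (2 + s) * x ^ 2 * y ^ 2 + s * x * y ^ 3 + y ^ 4"
    unfolding wp w5 s' s_def[symmetric] by (simp add: s_def algebra_simps)
  finally have 1: "f w * f (w ^ 4) = \<dots>" .
  have "f (w ^ 2) * f (w ^ 3) = x ^ 4 - (w ^ 2 + w ^ 3) * x ^ 3 * y - (w ^ 4 + w ^ 6) * x ^ 2 * y ^ 2
      + w ^ 5 * x ^ 2 * y ^ 2 + (w ^ 8 + w ^ 7) * x * y ^ 3 + w ^ 10 * y ^ 4"
    by (simp add: f_def algebra_simps eval_nat_numeral)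
  also have "\<dots> = x ^ 4 + (1 + s) * x ^ 3 * y + (1 - s) * x ^ 2 * y ^ 2 - (1 + s) * x * y ^ 3 + y ^ 4"
    using s' unfolding wp w5 s_def by algebra
  finally have 2: "f (w ^ 2) * f (w ^ 3) = \<dots>" .
  have f1: "f 1 = x ^ 2 - x * y - y ^ 2" by (simp add: f_def)
  have "f 1 * f w * f (w ^ 2) * f (w ^ 3) * f (w ^ 4) = f 1 * (f w * f (w ^ 4)) * (f (w ^ 2) * f (w ^ 3))"
    by (simp only: mult_ac)
  also have "\<dots> = x ^ 10 - 11 * x ^ 5 * y ^ 5 - y ^ 10"
    unfolding 1 2 f1 using s2 by algebra
  finally show ?thesis .
qed

text \<open>The $x$, $y$ and $D$ of the introduction.\<close>

definition XB :: "complex fps" where "XB = dilate PB"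
definition YA :: "complex fps" where "YA = fps_X * dilate PA"
definition DP :: "complex fps" where "DP = dilate P5"

lemma P5_dilate: "P5 = dilate (PA * PB) * DP"
  unfolding DP_def by (subst P5_eq) (simp only: euler_eq dilate_mult)

lemma nth_0:
  "PA $ 0 = 1" "PB $ 0 = 1" "P5 $ 0 = 1" "euler $ 0 = 1"
proof -
  have q: "qpoch (fps_X ^ i) (fps_X ^ s) $ 0 = 1" if "i > 0" "s > 0" for i s
  proof -
    from qprod_tendsto_qpoch[OF that]
    have "\<forall>\<^sub>F N in sequentially. qprod N (fps_X ^ i) (fps_X ^ s) $ 0 = qpoch (fps_X ^ i) (fps_X ^ s) $ 0"
      unfolding tendsto_fps_iff by blast
    then show ?thesis using that by (auto simp: eventually_sequentially)
  qed
  show "PA $ 0 = 1" "PB $ 0 = 1" "P5 $ 0 = 1"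
    using q[of 1 5] q[of 4 5] q[of 2 5] q[of 3 5] q[of 5 5]
    by (simp_all add: PA_def PB_def P5_def qpochs_def)
  then show "euler $ 0 = 1" by (simp add: euler_eq)
qed

lemma nonzero_fps: "PA \<noteq> 0" "PB \<noteq> 0" "P5 \<noteq> 0" "euler \<noteq> 0" "DP \<noteq> 0" "dilate PA \<noteq> 0" "dilate PB \<noteq> 0"
proof -
  have *: "f \<noteq> 0" if "f $ 0 = 1" for f :: "complex fps" using that by auto
  show "PA \<noteq> 0" "PB \<noteq> 0" "P5 \<noteq> 0" "euler \<noteq> 0" "DP \<noteq> 0" "dilate PA \<noteq> 0" "dilate PB \<noteq> 0"
    by (intro *; simp add: DP_def nth_0)+
qed

context fifth_root
begin

text \<open>A root of s^2 + s - 1, namely \<zeta> + 1/\<zeta>. Replacing \<zeta> by \<zeta>^2 gives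
  the other root -1 - s1.\<close>

definition s1 :: complex where "s1 = \<zeta> + \<zeta> ^ 4"

lemma s2_eq: "\<zeta> ^ 2 + \<zeta> ^ 3 = - 1 - s1"
  using sum_powers unfolding s1_def by algebra

lemma theta_zeta: "theta \<zeta> = fps_const (1 - \<zeta> ^ 4) * DP * (XB - fps_const (1 + s1) * YA)"
proof -
  have "\<zeta> - \<zeta> ^ 3 = (1 - \<zeta> ^ 4) * (1 + s1)"
    using sum_powers unfolding s1_def by algebra
  then have "fps_const (\<zeta> - \<zeta> ^ 3) = fps_const (1 - \<zeta> ^ 4) * fps_const (1 + s1)" by simp
  then show ?thesis
    using theta_dissection[OF power5]
    by (simp only: dilate_mult XB_def YA_def DP_def right_diff_distrib mult_ac)
qed

end

lemma (in fifth_root) s1_square: "s1 ^ 2 = 1 - s1"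
  using sum_powers unfolding s1_def by algebra

lemma (in fifth_root) theta_zeta2:
  "theta (\<zeta> ^ 2) = fps_const (1 - \<zeta> ^ 3) * DP * (XB + fps_const s1 * YA)"
proof -
  interpret r2: fifth_root "\<zeta> ^ 2" by (rule fifth_root_powers)
  have 1: "1 + r2.s1 = - s1" "(\<zeta> ^ 2) ^ 4 = \<zeta> ^ 3"
    using sum_powers unfolding r2.s1_def s1_def by algebra+
  have "XB - fps_const (- s1) * YA = XB + fps_const s1 * YA"
    by (simp flip: fps_const_neg)
  then show ?thesis using r2.theta_zeta unfolding 1 by simp
qed

lemma (in fifth_root) theta_factors:
  "(XB - fps_const (1 + s1) * YA) * (XB + fps_const s1 * YA) = XB ^ 2 - XB * YA - YA ^ 2"
proof -
  have "fps_const s1 ^ 2 = fps_const (1 - s1)" by (simp add: fps_const_power s1_square)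
  then have "fps_const s1 ^ 2 = 1 - fps_const s1" by (simp flip: fps_const_sub)
  moreover have "fps_const (1 + s1) = 1 + fps_const s1" by (simp flip: fps_const_add)
  ultimately show ?thesis by algebra
qed

text \<open>Multiplying \<open>part_gf_theta\<close> at \<zeta> and at \<zeta>^2 brings together
  \<open>part_gf\<close> at all four primitive roots, which \<open>prod_part_gf\<close> evaluates;
  the two theta factors are conjugate.\<close>

lemma (in fifth_root) euler_P5: "euler * P5 = DP ^ 2 * (XB ^ 2 - XB * YA - YA ^ 2)"
proof -
  let ?k = "fps_const (1 - \<zeta> ^ 4) * fps_const (1 - \<zeta> ^ 3)"
  have i: "inverse \<zeta> = \<zeta> ^ 4" "inverse (\<zeta> ^ 2) = \<zeta> ^ 3"
    using power5 nonzero by (auto simp: field_simps eval_nat_numeral)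
  have k0: "?k \<noteq> 0"
  proof -
    have "\<zeta> ^ 4 \<noteq> 1" "\<zeta> ^ 3 \<noteq> 1"
      using sum_powers power5 by algebra+
    then show ?thesis by simp
  qed
  have "\<zeta> ^ 2 \<noteq> 0" using nonzero by simp
  note p = part_gf_theta[OF nonzero, unfolded i] part_gf_theta[OF this, unfolded i]
  have "?k * euler ^ 2 * P5 = (part_gf \<zeta> * part_gf (\<zeta> ^ 4) * theta \<zeta>)
      * (part_gf (\<zeta> ^ 2) * part_gf (\<zeta> ^ 3) * theta (\<zeta> ^ 2)) * P5"
    unfolding p by (simp only: power2_eq_square mult_ac)
  also have "\<dots> = (part_gf \<zeta> * part_gf (\<zeta> ^ 2) * part_gf (\<zeta> ^ 3) * part_gf (\<zeta> ^ 4) * P5)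
      * (theta \<zeta> * theta (\<zeta> ^ 2))"
    by (simp only: mult_ac)
  also have "\<dots> = euler * (?k * (DP ^ 2 * ((XB - fps_const (1 + s1) * YA) * (XB + fps_const s1 * YA))))"
    unfolding prod_part_gf theta_zeta theta_zeta2 by (simp only: power2_eq_square mult_ac)
  finally have "(?k * euler) * (euler * P5) = (?k * euler) * (DP ^ 2 * (XB ^ 2 - XB * YA - YA ^ 2))"
    unfolding theta_factors by (simp only: power2_eq_square mult_ac)
  then show ?thesis using k0 nonzero_fps by (simp only: mult_cancel_left) auto
qed

text \<open>As \<open>dilate (PA * PB)\<close> is x y / q, this is the classical dissection E_1 = D
  (B/A - q - q^2 A/B), with A and B taken at q^5, freed of denominators.\<close>

lemma euler_AB: "euler * dilate (PA * PB) = DP * (XB ^ 2 - XB * YA - YA ^ 2)"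
proof -
  obtain \<zeta> where "fifth_root \<zeta>" using ex_fifth_root by blast
  from fifth_root.euler_P5[OF this] P5_dilate
  have "DP * (euler * dilate (PA * PB)) = DP * (DP * (XB ^ 2 - XB * YA - YA ^ 2))"
    by algebra
  then show ?thesis using nonzero_fps by (simp only: mult_cancel_left) auto
qed

section \<open>Rotations of q by fifth roots of unity\<close>

abbreviation (input) rotate :: "complex \<Rightarrow> complex fps \<Rightarrow> complex fps" where
  "rotate c f \<equiv> f oo (fps_const c * fps_X)"

lemma rotate_mult: "rotate c (f * g) = rotate c f * rotate c g"
  and rotate_power: "rotate c (f ^ k) = rotate c f ^ k"
  and rotate_diff: "rotate c (f - g) = rotate c f - rotate c g"
  and rotate_X: "rotate c fps_X = fps_const c * fps_X"
  by (simp_all add: fps_compose_mult_distrib fps_compose_power fps_compose_sub_distrib)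

lemma rotate_dilate:
  assumes "c ^ 5 = 1"
  shows "rotate c (dilate f) = dilate f"
proof -
  have "rotate c (fps_X ^ 5) = fps_X ^ 5"
    using assms by (simp add: rotate_power rotate_X power_mult_distrib fps_const_power)
  then show ?thesis
    using fps_compose_assoc[of "fps_const c * fps_X" "fps_X ^ 5" f] by simp
qed

text \<open>A rotation by \<zeta>^k multiplies the monomial of each factor by (\<zeta>^i)^k. As
  \<zeta>^i is primitive again, \<open>prod_roots\<close> applies to each factor separately.\<close>

lemma (in fifth_root) rotate_qpoch:
  assumes i: "fifth_root (\<zeta> ^ i)" "i > 0"
  defines "f \<equiv> qpoch (fps_X ^ i) (fps_X ^ 5)"
  shows "rotate 1 f * rotate \<zeta> f * rotate (\<zeta> ^ 2) f * rotate (\<zeta> ^ 3) f * rotate (\<zeta> ^ 4) f = dilate f"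
proof (rule LIMSEQ_unique)
  let ?q = "\<lambda>N. qprod N (fps_X ^ i) (fps_X ^ 5) :: complex fps"
  have lim: "?q \<longlonglongrightarrow> f" unfolding f_def using i by (intro qprod_tendsto_qpoch) auto
  show "(\<lambda>N. dilate (?q N)) \<longlonglongrightarrow> dilate f"
    by (rule tendsto_compose_fps[OF lim])
  have fac: "rotate (\<zeta> ^ k) (1 - fps_X ^ i * (fps_X ^ 5) ^ n)
      = 1 - fps_const (\<zeta> ^ i) ^ k * (fps_X ^ i * (fps_X ^ 5) ^ n)" for k n
  proof -
    have "(\<zeta> ^ k) ^ 5 = 1" by (metis power5 power_commutes power_mult mult.commute power_one)
    then have X5: "rotate (\<zeta> ^ k) (fps_X ^ 5) = fps_X ^ 5"
      using rotate_dilate[of "\<zeta> ^ k" fps_X] by simp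
    have Xi: "rotate (\<zeta> ^ k) (fps_X ^ i) = fps_const (\<zeta> ^ i) ^ k * fps_X ^ i"
      unfolding rotate_power rotate_X power_mult_distrib
      by (simp add: fps_const_power mult.commute flip: power_mult)
    show ?thesis
      by (simp only: rotate_diff fps_compose_1 rotate_mult rotate_power[of "fps_X ^ 5"] X5 Xi mult.assoc)
  qed
  have "rotate 1 (?q N) * rotate \<zeta> (?q N) * rotate (\<zeta> ^ 2) (?q N) * rotate (\<zeta> ^ 3) (?q N) * rotate (\<zeta> ^ 4) (?q N)
      = dilate (?q N)" for N
  proof (induction N)
    case (Suc N)
    let ?Y = "fps_X ^ i * (fps_X ^ 5) ^ N :: complex fps" and ?v = "fps_const (\<zeta> ^ i)"
    have "dilate (1 - ?Y) = 1 - ?Y ^ 5"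
      by (simp add: fps_compose_sub_distrib dilate_mult dilate_power dilate_X power_mult_distrib mult_ac
          flip: power_mult)
    also have "\<dots> = (1 - ?Y) * (1 - ?v * ?Y) * (1 - ?v ^ 2 * ?Y) * (1 - ?v ^ 3 * ?Y) * (1 - ?v ^ 4 * ?Y)"
      by (rule fifth_root.prod_roots[OF i(1), symmetric])
    finally have D: "dilate (1 - ?Y) = \<dots>" .
    note rot = fac[where k = 0 and n = N, unfolded power_0 mult_1] fac[where k = 1 and n = N, unfolded power_one_right] fac[where k = 2 and n = N]
      fac[where k = 3 and n = N] fac[where k = 4 and n = N]
    show ?case
      unfolding qprod_Suc rotate_mult dilate_mult Suc.IH[symmetric] rot D by (simp only: mult_ac)
  qed simp
  note prod = this
  show "(\<lambda>N. dilate (?q N)) \<longlonglongrightarrow>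
      rotate 1 f * rotate \<zeta> f * rotate (\<zeta> ^ 2) f * rotate (\<zeta> ^ 3) f * rotate (\<zeta> ^ 4) f"
    unfolding prod[symmetric] by (intro tendsto_mult_fps tendsto_compose_fps lim)
qed

lemma (in fifth_root) rotate_PA_PB:
  "rotate 1 (PA * PB) * rotate \<zeta> (PA * PB) * rotate (\<zeta> ^ 2) (PA * PB) * rotate (\<zeta> ^ 3) (PA * PB)
     * rotate (\<zeta> ^ 4) (PA * PB) = dilate (PA * PB)"
proof -
  have f1: "fifth_root (\<zeta> ^ 1)" using fifth_root_axioms by simp
  have P: "PA * PB = (qpoch (fps_X ^ 1) (fps_X ^ 5) * qpoch (fps_X ^ 4) (fps_X ^ 5))
      * (qpoch (fps_X ^ 2) (fps_X ^ 5) * qpoch (fps_X ^ 3) (fps_X ^ 5))"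
    by (simp add: PA_def PB_def qpochs_def)
  have "rotate 1 (PA * PB) * rotate \<zeta> (PA * PB) * rotate (\<zeta> ^ 2) (PA * PB) * rotate (\<zeta> ^ 3) (PA * PB)
     * rotate (\<zeta> ^ 4) (PA * PB)
    = (let r = (\<lambda>i. rotate 1 (qpoch (fps_X ^ i) (fps_X ^ 5)) * rotate \<zeta> (qpoch (fps_X ^ i) (fps_X ^ 5))
        * rotate (\<zeta> ^ 2) (qpoch (fps_X ^ i) (fps_X ^ 5)) * rotate (\<zeta> ^ 3) (qpoch (fps_X ^ i) (fps_X ^ 5))
        * rotate (\<zeta> ^ 4) (qpoch (fps_X ^ i) (fps_X ^ 5))) in (r 1 * r 4) * (r 2 * r 3))"
    unfolding P rotate_mult Let_def by (simp only: mult_ac)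
  also have "\<dots> = dilate (PA * PB)"
    unfolding Let_def rotate_qpoch[OF f1 zero_less_one] rotate_qpoch[OF fifth_root_powers(1) zero_less_numeral]
      rotate_qpoch[OF fifth_root_powers(2) zero_less_numeral] rotate_qpoch[OF fifth_root_powers(3) zero_less_numeral]
    unfolding P dilate_mult ..
  finally show ?thesis .
qed

text \<open>\<open>P5\<close> and \<open>DP\<close> are series in q^5 and hence fixed by the
  rotations. With a = \<open>dilate (PA * PB)\<close>, the five images of A B \<open>P5\<close>^2
  multiply to a \<open>P5\<close>^10; substituting \<open>P5\<close> = a \<open>DP\<close> gives the
  exponent 11.\<close>

lemma rogers_ramanujan_dilate:
  "XB ^ 10 - 11 * XB ^ 5 * YA ^ 5 - YA ^ 10 = dilate (PA * PB) ^ 11"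
proof -
  obtain \<zeta> where "fifth_root \<zeta>" using ex_fifth_root by blast
  then interpret fifth_root \<zeta> .
  let ?q = "\<lambda>u. XB ^ 2 - u * XB * YA - u ^ 2 * YA ^ 2"
  have rot: "rotate (\<zeta> ^ k) (PA * PB) * P5 ^ 2 = DP ^ 2 * ?q (w ^ k)" for k
  proof -
    have c: "(\<zeta> ^ k) ^ 5 = 1" by (metis power5 power_commutes power_mult mult.commute power_one)
    have P: "rotate (\<zeta> ^ k) P5 = P5" unfolding P5_eq by (rule rotate_dilate[OF c])
    have "rotate (\<zeta> ^ k) (PA * PB * P5 * P5) = rotate (\<zeta> ^ k) (DP ^ 2 * (XB ^ 2 - XB * YA - YA ^ 2))"
      using euler_P5 unfolding euler_eq by (rule arg_cong)
    moreover have "rotate (\<zeta> ^ k) YA = w ^ k * YA"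
      unfolding YA_def rotate_mult rotate_X rotate_dilate[OF c] by (simp add: fps_const_power)
    moreover have "rotate (\<zeta> ^ k) XB = XB" "rotate (\<zeta> ^ k) DP = DP"
      unfolding XB_def DP_def by (rule rotate_dilate[OF c])+
    ultimately show ?thesis
      unfolding rotate_mult rotate_power rotate_diff P power2_eq_square by (simp only: mult_ac)
  qed
  let ?r = "\<lambda>k. rotate (\<zeta> ^ k) (PA * PB)"
  have pow10: "D ^ 10 * (a * b * c * d * e) = (D ^ 2 * a) * (D ^ 2 * b) * (D ^ 2 * c) * (D ^ 2 * d) * (D ^ 2 * e)"
    for D a b c d e :: "complex fps"
    by (simp add: eval_nat_numeral mult_ac)
  have "DP ^ 10 * (?q 1 * ?q w * ?q (w ^ 2) * ?q (w ^ 3) * ?q (w ^ 4))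
      = (DP ^ 2 * ?q (w ^ 0)) * (DP ^ 2 * ?q (w ^ 1)) * (DP ^ 2 * ?q (w ^ 2)) * (DP ^ 2 * ?q (w ^ 3))
        * (DP ^ 2 * ?q (w ^ 4))"
    by (simp only: pow10 power_0 power_one_right)
  also have "\<dots> = P5 ^ 10 * (?r 0 * ?r 1 * ?r 2 * ?r 3 * ?r 4)"
    unfolding rot[symmetric] pow10 by (simp only: mult_ac)
  also have "?r 0 * ?r 1 * ?r 2 * ?r 3 * ?r 4 = dilate (PA * PB)"
    using rotate_PA_PB by simp
  also have "P5 ^ 10 * dilate (PA * PB) = DP ^ 10 * dilate (PA * PB) ^ 11"
    by (subst P5_dilate) (simp add: power_mult_distrib, simp add: eval_nat_numeral mult_ac)
  finally have "?q 1 * ?q w * ?q (w ^ 2) * ?q (w ^ 3) * ?q (w ^ 4) = dilate (PA * PB) ^ 11"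
    using nonzero_fps by (simp only: mult_cancel_left) auto
  then show ?thesis unfolding prod_norm_form[OF w_sum] .
qed

text \<open>The cube of x^2 - x y - y^2 is x^6 - 3 x^5 y + 5 x^3 y^3 - 3 x y^5 - y^6. As y carries
  one factor q, only the classes 0, 1 and 3 occur, exactly those of
  \<open>euler_cube_dissection\<close>. Classes 0 and 1 yield the two moments.\<close>

lemma theta_moments:
  "(10 * theta_moment1 + PB * P5) * (PA * PB) ^ 3 = P5 ^ 3 * (PB ^ 6 - 3 * fps_X * PB * PA ^ 5)"
  "(10 * theta_moment3 + 3 * (PA * P5)) * (PA * PB) ^ 3 = P5 ^ 3 * (3 * PB ^ 5 * PA + fps_X * PA ^ 6)"
proof -
  let ?c = "(PA * PB) ^ 3"
  \<comment> \<open>List lookup gives a function on classes, and \<open>dissect\<close> reads only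
    the indices 0 to 4.\<close>
  define f where "f = (!) [(10 * theta_moment1 + PB * P5) * ?c, - ((10 * theta_moment3 + 3 * (PA * P5)) * ?c), 0,
      5 * P5 ^ 3 * ?c, 0]"
  define g where "g = (!) [P5 ^ 3 * (PB ^ 6 - 3 * fps_X * PB * PA ^ 5),
      - (P5 ^ 3 * (3 * PB ^ 5 * PA + fps_X * PA ^ 6)), 0, 5 * P5 ^ 3 * ?c, 0]"
  have f: "f 0 = (10 * theta_moment1 + PB * P5) * ?c" "f 1 = - ((10 * theta_moment3 + 3 * (PA * P5)) * ?c)"
    "f 2 = 0" "f 3 = 5 * P5 ^ 3 * ?c" "f 4 = 0"
    by (simp_all add: f_def)
  have g: "g 0 = P5 ^ 3 * (PB ^ 6 - 3 * fps_X * PB * PA ^ 5)"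
    "g 1 = - (P5 ^ 3 * (3 * PB ^ 5 * PA + fps_X * PA ^ 6))"
    "g 2 = 0" "g 3 = 5 * P5 ^ 3 * ?c" "g 4 = 0"
    by (simp_all add: g_def)
  note dilate_simps = dilate_mult dilate_power dilate_X dilate_numeral fps_compose_uminus
    fps_compose_add_distrib fps_compose_sub_distrib fps_compose_0
  have "dissect f = euler ^ 3 * dilate ?c"
    unfolding dissect_expand f euler_cube_dissection dilate_simps by algebra
  also have "\<dots> = (DP * (XB ^ 2 - XB * YA - YA ^ 2)) ^ 3"
    unfolding euler_AB[symmetric] power_mult_distrib[of euler] dilate_power ..
  also have "(DP * (XB ^ 2 - XB * YA - YA ^ 2)) ^ 3 = DP ^ 3 * (XB ^ 6 - 3 * XB * YA ^ 5)
      - DP ^ 3 * (3 * XB ^ 5 * YA + YA ^ 6) + 5 * DP ^ 3 * (XB * YA) ^ 3"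
    by algebra
  also have "\<dots> = dissect g"
    unfolding dissect_expand g DP_def XB_def YA_def dilate_simps by algebra
  finally have "dissect f = dissect g" .
  from dissect_eqD[OF this, of 0] dissect_eqD[OF this, of 1]
  show "(10 * theta_moment1 + PB * P5) * ?c = P5 ^ 3 * (PB ^ 6 - 3 * fps_X * PB * PA ^ 5)"
    "(10 * theta_moment3 + 3 * (PA * P5)) * ?c = P5 ^ 3 * (3 * PB ^ 5 * PA + fps_X * PA ^ 6)"
    unfolding f g by simp_all
qed

text \<open>The right-hand side of \<open>crank_gf_deriv_eq\<close> at \<zeta>, with a, D, X
  standing for \<open>dilate (PA * PB)\<close>, \<open>DP\<close>, \<open>fps_X\<close>. The moments
  enter with coefficient 5 but are known with 10, over a^3; this explains the factor 2 a^3. The gain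
  is the factor x + t y on the right, which belongs to \<open>theta \<zeta>\<close>.\<close>

lemma theta_deriv_algebra:
  fixes Z x y a D m1 m3 X :: "'a::idom"
  assumes Z: "Z ^ 4 + Z ^ 3 + Z ^ 2 + Z + 1 = 0"
    and m1: "a ^ 3 * (10 * m1 + x * D) = D ^ 3 * (x ^ 6 - 3 * x * y ^ 5)"
    and m3: "a ^ 3 * (10 * m3 + 3 * (y * D)) = D ^ 3 * (3 * x ^ 5 * y + y ^ 6)"
    and X: "x * y = X * a"
  defines "t \<equiv> Z ^ 2 + Z ^ 3"
  shows "2 * a ^ 3 * (Z ^ 4 * ((1 - Z ^ 4) * D * (x + t * y))
      - (1 - Z ^ 4) * ((5 + 5 * Z ^ 4) * m1 + Z ^ 4 * (x * D)
        - ((5 * Z + 5 * Z ^ 3) * m3 + (Z + 2 * Z ^ 3) * (y * D)) + 5 * Z ^ 2 * X ^ 3 * D ^ 3))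
    = (1 - Z ^ 4) * D * Z ^ 2 * (x + t * y) * (a ^ 3 * t
       - D ^ 2 * (t * x ^ 5 + (2 + 4 * t) * x ^ 4 * y + (2 * t - 4) * x ^ 3 * y ^ 2 + (8 + 6 * t) * x ^ 2 * y ^ 3
         - (6 + 2 * t) * x * y ^ 4 + (2 + t) * y ^ 5))"
proof -
  have "Z ^ 5 - 1 = (Z - 1) * (Z ^ 4 + Z ^ 3 + Z ^ 2 + Z + 1)"
    by (simp add: algebra_simps eval_nat_numeral)
  then have Z5: "Z ^ 5 = 1" using Z by simp
  have t2: "t ^ 2 = 1 - t" using Z unfolding t_def by algebra
  have e1: "1 + Z ^ 4 = Z ^ 2 * t" using Z unfolding t_def by algebra
  have e2: "Z + Z ^ 3 = - (Z ^ 2 * (1 + t))" using Z unfolding t_def by algebra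
  have e3: "(1 - Z ^ 4) * t = Z ^ 3 - Z" using Z unfolding t_def by algebra
  have X3: "x ^ 3 * y ^ 3 = a ^ 3 * X ^ 3"
    using X by (metis power_mult_distrib mult.commute)
  define K where "K = t * x ^ 5 + (2 + 4 * t) * x ^ 4 * y + (2 * t - 4) * x ^ 3 * y ^ 2
    + (8 + 6 * t) * x ^ 2 * y ^ 3 - (6 + 2 * t) * x * y ^ 4 + (2 + t) * y ^ 5"
  define H where "H = t * (x ^ 6 - 3 * x * y ^ 5) + (1 + t) * (3 * x ^ 5 * y + y ^ 6) + 10 * (x ^ 3 * y ^ 3)"
  \<comment> \<open>The decisive divisibility: t^2 = 1 - t makes the sextic \<open>H\<close> a
    multiple of x + t y.\<close>
  have H: "H = (x + t * y) * K"
    unfolding H_def K_def using t2 by algebra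
  have m1': "a ^ 3 * (10 * m1) = D ^ 3 * (x ^ 6 - 3 * x * y ^ 5) - a ^ 3 * (x * D)"
    and m3': "a ^ 3 * (10 * m3) = D ^ 3 * (3 * x ^ 5 * y + y ^ 6) - 3 * a ^ 3 * (y * D)"
    using m1 m3 by (simp_all add: algebra_simps)
  have "2 * a ^ 3 * ((5 + 5 * Z ^ 4) * m1 + Z ^ 4 * (x * D)
        - ((5 * Z + 5 * Z ^ 3) * m3 + (Z + 2 * Z ^ 3) * (y * D)) + 5 * Z ^ 2 * X ^ 3 * D ^ 3)
    = (1 + Z ^ 4) * (a ^ 3 * (10 * m1)) + 2 * Z ^ 4 * a ^ 3 * x * D - (Z + Z ^ 3) * (a ^ 3 * (10 * m3))
      - 2 * (Z + 2 * Z ^ 3) * a ^ 3 * y * D + 10 * Z ^ 2 * (a ^ 3 * X ^ 3) * D ^ 3"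
    by (simp add: algebra_simps)
  also have "\<dots> = D ^ 3 * ((1 + Z ^ 4) * (x ^ 6 - 3 * x * y ^ 5) - (Z + Z ^ 3) * (3 * x ^ 5 * y + y ^ 6)
        + 10 * Z ^ 2 * (x ^ 3 * y ^ 3)) - a ^ 3 * D * ((1 - Z ^ 4) * x + (Z ^ 3 - Z) * y)"
    unfolding m1' m3' X3 by (simp add: algebra_simps)
  also have "\<dots> = Z ^ 2 * D ^ 3 * H - a ^ 3 * D * ((1 - Z ^ 4) * (x + t * y))"
    unfolding e1 e2 H_def e3[symmetric] by (simp add: algebra_simps)
  finally have *: "2 * a ^ 3 * ((5 + 5 * Z ^ 4) * m1 + Z ^ 4 * (x * D)
        - ((5 * Z + 5 * Z ^ 3) * m3 + (Z + 2 * Z ^ 3) * (y * D)) + 5 * Z ^ 2 * X ^ 3 * D ^ 3) = \<dots>" .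
  have "2 * a ^ 3 * (Z ^ 4 * ((1 - Z ^ 4) * D * (x + t * y)) - (1 - Z ^ 4) * I)
      = 2 * a ^ 3 * Z ^ 4 * (1 - Z ^ 4) * D * (x + t * y) - (1 - Z ^ 4) * (2 * a ^ 3 * I)" for I
    by (simp add: algebra_simps)
  then have "2 * a ^ 3 * (Z ^ 4 * ((1 - Z ^ 4) * D * (x + t * y))
      - (1 - Z ^ 4) * ((5 + 5 * Z ^ 4) * m1 + Z ^ 4 * (x * D)
        - ((5 * Z + 5 * Z ^ 3) * m3 + (Z + 2 * Z ^ 3) * (y * D)) + 5 * Z ^ 2 * X ^ 3 * D ^ 3))
    = 2 * a ^ 3 * Z ^ 4 * (1 - Z ^ 4) * D * (x + t * y)
      - (1 - Z ^ 4) * (Z ^ 2 * D ^ 3 * H - a ^ 3 * D * ((1 - Z ^ 4) * (x + t * y)))"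
    by (simp only: *)
  also have "\<dots> = (1 - Z ^ 4) * D * (a ^ 3 * (1 + Z ^ 4) * (x + t * y) - Z ^ 2 * D ^ 2 * H)"
    by (simp add: algebra_simps power2_eq_square power3_eq_cube)
  also have "\<dots> = (1 - Z ^ 4) * D * Z ^ 2 * (x + t * y) * (a ^ 3 * t - D ^ 2 * K)"
  proof -
    have "k * D * (a ^ 3 * (Z ^ 2 * t) * T - Z ^ 2 * D ^ 2 * (T * K)) = k * D * Z ^ 2 * T * (a ^ 3 * t - D ^ 2 * K)"
      for k T by (simp add: algebra_simps)
    then show ?thesis unfolding e1 H .
  qed
  finally show ?thesis unfolding K_def .
qed

section \<open>The generating function as a polynomial\<close>

text \<open>For \<open>t\<^sup>2 = 1 - t\<close> this is the quotient of
  \<open>t (x\<^sup>6 - 3 x y\<^sup>5) + (1 + t) (3 x\<^sup>5 y + y\<^sup>6) + 10 x\<^sup>3 y\<^sup>3\<close> by \<open>x + t y\<close>.\<close>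

definition quintic :: "'a::idom \<Rightarrow> 'a \<Rightarrow> 'a \<Rightarrow> 'a" where
  "quintic t x y = t * x ^ 5 + (2 + 4 * t) * x ^ 4 * y + (2 * t - 4) * x ^ 3 * y ^ 2
    + (8 + 6 * t) * x ^ 2 * y ^ 3 - (6 + 2 * t) * x * y ^ 4 + (2 + t) * y ^ 5"

text \<open>The two summands are exchanged by t to -1 - t, the effect of replacing \<zeta> by
  \<zeta>^2, so their sum is free of t. The weight 2 - t comes from the Fourier coefficient
  \<open>c1\<close>.\<close>

lemma quintic_symmetrize:
  fixes t x y a D :: "'a::idom"
  assumes "t ^ 2 = 1 - t"
  shows "(2 - t) * (x - (1 + t) * y) * (a ^ 3 * t - D ^ 2 * quintic t x y)
     + (3 + t) * (x + t * y) * (a ^ 3 * (- 1 - t) - D ^ 2 * quintic (- 1 - t) x y)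
     = 5 * (D ^ 2 * (x ^ 6 + 3 * x ^ 5 * y + 10 * x ^ 4 * y ^ 2 + 10 * x ^ 2 * y ^ 4 - 3 * x * y ^ 5 + y ^ 6)
        - a ^ 3 * (x + y))"
proof -
  have 1: "(2 - t) * (x - (1 + t) * y) * t + (3 + t) * (x + t * y) * (- 1 - t) = - 5 * (x + y)"
    using assms by algebra
  have 2: "(2 - t) * (x - (1 + t) * y) * quintic t x y + (3 + t) * (x + t * y) * quintic (- 1 - t) x y
      = - 5 * (x ^ 6 + 3 * x ^ 5 * y + 10 * x ^ 4 * y ^ 2 + 10 * x ^ 2 * y ^ 4 - 3 * x * y ^ 5 + y ^ 6)"
    unfolding quintic_def using assms by algebra
  have lin: "p * (a ^ 3 * t - D ^ 2 * u) + r * (a ^ 3 * (- 1 - t) - D ^ 2 * v)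
      = a ^ 3 * (p * t + r * (- 1 - t)) - D ^ 2 * (p * u + r * v)" for p r u v
    by (simp add: algebra_simps)
  show ?thesis by (simp only: lin 1 2) (simp add: algebra_simps)
qed

lemma theta_moments_dilate:
  "dilate (PA * PB) ^ 3 * (10 * dilate theta_moment1 + XB * DP) = DP ^ 3 * (XB ^ 6 - 3 * XB * YA ^ 5)"
  "dilate (PA * PB) ^ 3 * (10 * (fps_X * dilate theta_moment3) + 3 * (YA * DP))
     = DP ^ 3 * (3 * XB ^ 5 * YA + YA ^ 6)"
proof -
  note dilate_simps = dilate_mult dilate_power dilate_X dilate_numeral
    fps_compose_add_distrib fps_compose_sub_distrib
  show "dilate (PA * PB) ^ 3 * (10 * dilate theta_moment1 + XB * DP) = DP ^ 3 * (XB ^ 6 - 3 * XB * YA ^ 5)"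
    using arg_cong[OF theta_moments(1), of dilate] unfolding dilate_simps XB_def YA_def DP_def
    by algebra
  show "dilate (PA * PB) ^ 3 * (10 * (fps_X * dilate theta_moment3) + 3 * (YA * DP))
     = DP ^ 3 * (3 * XB ^ 5 * YA + YA ^ 6)"
    using arg_cong[OF theta_moments(2), of dilate] unfolding dilate_simps XB_def YA_def DP_def
    by algebra
qed

text \<open>These push \<open>fps_const\<close> inward as far as \<zeta>, so that scalar identities
  become polynomial identities in \<open>w\<close>.\<close>

lemmas const_hom = fps_const_add[symmetric] fps_const_sub[symmetric] fps_const_mult[symmetric]
  fps_const_power[symmetric] numeral_fps_const[symmetric] fps_const_1_eq_1

context fifth_root
begin

definition "t = w ^ 2 + w ^ 3"

lemma t_const: "t = - fps_const (1 + s1)"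
proof -
  have "fps_const (\<zeta> ^ 2 + \<zeta> ^ 3) = fps_const (- (1 + s1))" using s2_eq by simp
  then show ?thesis unfolding t_def by (simp add: fps_const_power)
qed

lemma t_square: "t ^ 2 = 1 - t"
  using w_sum unfolding t_def by algebra

lemma s1_const: "fps_const s1 = - (1 + t)"
  unfolding t_const by (simp only: const_hom) (simp only: minus_add_distrib minus_minus add_minus_cancel)

text \<open>One \<open>theta \<zeta>\<close> cancels by \<open>theta_deriv_algebra\<close>. The
  linear factor \<open>T1\<close> of the other is multiplied by its conjugate \<open>T2\<close>,
  which turns it into \<open>euler * P5\<close> by \<open>T12\<close>.\<close>

lemma crank_gf_deriv_root:
  "10 * dilate (PA * PB) ^ 3 * euler ^ 2 * P5 * (fps_const c1 * crank_gf_deriv \<zeta>)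
    = DP * ((2 - t) * (XB - (1 + t) * YA) * (dilate (PA * PB) ^ 3 * t - DP ^ 2 * quintic t XB YA))"
proof -
  let ?a = "dilate (PA * PB)" and ?D = "crank_gf_deriv \<zeta>" and ?k = "1 - w ^ 4"
  define T1 T2 R where "T1 = XB + t * YA" and "T2 = XB - (1 + t) * YA"
    and "R = ?a ^ 3 * t - DP ^ 2 * quintic t XB YA"
  have k: "fps_const (1 - \<zeta> ^ 4) = ?k" by (simp only: const_hom)
  have k0: "?k \<noteq> 0"
  proof -
    have "\<zeta> ^ 4 \<noteq> 1" using sum_powers power5 by algebra
    then show ?thesis unfolding k[symmetric] by simp
  qed
  have th: "theta \<zeta> = ?k * DP * T1"
    unfolding theta_zeta k T1_def t_const by (simp only: mult_minus_left add_uminus_conv_diff)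
  have T12: "DP ^ 2 * (T1 * T2) = euler * P5"
  proof -
    have "fps_const (1 + s1) = - t" by (simp only: t_const minus_minus)
    then show ?thesis
      unfolding euler_P5 theta_factors[symmetric] T1_def T2_def s1_const by (simp add: algebra_simps)
  qed
  then have T10: "T1 \<noteq> 0" using nonzero_fps by auto
  have th': "theta_deriv \<zeta> = (5 + 5 * w ^ 4) * dilate theta_moment1 + w ^ 4 * (XB * DP)
      - ((5 * w + 5 * w ^ 3) * (fps_X * dilate theta_moment3) + (w + 2 * w ^ 3) * (YA * DP))
      + 5 * w ^ 2 * fps_X ^ 3 * DP ^ 3"
    unfolding theta_deriv_dissection[OF power5] dilate_mult fps_compose_add_distrib dilate_const
      XB_def YA_def DP_def const_hom
    by (simp add: algebra_simps)
  have xy: "XB * YA = fps_X * ?a" by (simp add: XB_def YA_def dilate_mult mult_ac)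
  have "2 * ?a ^ 3 * (?D * euler * theta \<zeta> ^ 2) = ?k * DP * w ^ 2 * T1 * R"
    unfolding crank_gf_deriv_eq[OF nonzero] inverse_eq k
    unfolding th th' R_def quintic_def T1_def t_def
    using theta_deriv_algebra[OF w_sum theta_moments_dilate xy]
    by (simp only: fps_const_power)
  then have "(?k * DP * T1) * (2 * ?a ^ 3 * ?D * euler * ?k * DP * T1) = (?k * DP * T1) * (w ^ 2 * R)"
    unfolding th by (simp only: power2_eq_square mult_ac)
  then have "2 * ?a ^ 3 * ?D * euler * ?k * DP * T1 = w ^ 2 * R"
    using k0 nonzero_fps T10 by (simp only: mult_cancel_left) auto
  then have "(5 * fps_const c1 * DP * T2) * (2 * ?a ^ 3 * ?D * euler * ?k * DP * T1)
      = (5 * fps_const c1 * w ^ 2) * (DP * T2 * R)"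
    by (simp only: mult_ac)
  \<comment> \<open>The Fourier coefficient supplies the factor \<open>?k\<close> that cancels the
    one from \<open>theta \<zeta>\<close>; what remains depends on \<zeta> through t only.\<close>
  also have "5 * fps_const c1 * w ^ 2 = ?k * (2 - t)"
  proof -
    have "5 * c1 * \<zeta> ^ 2 = (1 - \<zeta> ^ 4) * (2 - (\<zeta> ^ 2 + \<zeta> ^ 3))"
      using sum_powers unfolding c1_def by (simp add: field_simps) algebra
    from arg_cong[OF this, of fps_const] show ?thesis
      unfolding t_def by (simp only: const_hom)
  qed
  also have "(5 * fps_const c1 * DP * T2) * (2 * ?a ^ 3 * ?D * euler * ?k * DP * T1)
      = ?k * (10 * ?a ^ 3 * euler * (DP ^ 2 * (T1 * T2)) * (fps_const c1 * ?D))"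
    by (simp add: power2_eq_square algebra_simps)
  finally have "?k * (10 * ?a ^ 3 * euler ^ 2 * P5 * (fps_const c1 * ?D)) = ?k * (DP * ((2 - t) * T2 * R))"
    unfolding T12 by (simp only: power2_eq_square mult_ac)
  then show ?thesis
    using k0 unfolding R_def T2_def by (simp only: mult_cancel_left) auto
qed

end

text \<open>The locale is used at \<zeta> and at \<zeta>^2: the second coefficient \<open>c2\<close>
  is \<open>c1\<close> formed with \<zeta>^2, so the two contributions are conjugate and
  \<open>quintic_symmetrize\<close> adds them.\<close>

lemma weighted_gf_sextic:
  "2 * dilate (PA * PB) ^ 2 * DP ^ 2 * (XB ^ 2 - XB * YA - YA ^ 2) ^ 2 * weighted_gf
    = DP ^ 2 * (XB ^ 6 + 3 * XB ^ 5 * YA + 10 * XB ^ 4 * YA ^ 2 + 10 * XB ^ 2 * YA ^ 4 - 3 * XB * YA ^ 5 + YA ^ 6)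
        - dilate (PA * PB) ^ 3 * (XB + YA)" (is "?L = ?R")
proof -
  obtain \<zeta> where "fifth_root \<zeta>" using ex_fifth_root by blast
  then interpret fifth_root \<zeta> .
  interpret r2: fifth_root "\<zeta> ^ 2" by (rule fifth_root_powers)
  let ?a = "dilate (PA * PB)"
  have t': "r2.t = - 1 - t"
    using w_sum unfolding r2.t_def t_def by (simp only: fps_const_power[symmetric]) algebra
  have c2: "r2.c1 = c2"
    using sum_powers unfolding r2.c1_def c2_def by (simp add: field_simps) algebra
  have "10 * ?a ^ 3 * euler ^ 2 * P5 * weighted_gf
    = 10 * ?a ^ 3 * euler ^ 2 * P5 * (fps_const c1 * crank_gf_deriv \<zeta>)
      + 10 * ?a ^ 3 * euler ^ 2 * P5 * (fps_const r2.c1 * crank_gf_deriv (\<zeta> ^ 2))"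
    unfolding weighted_gf_eq c2 by (simp only: distrib_left)
  also have "\<dots> = DP * ((2 - t) * (XB - (1 + t) * YA) * (?a ^ 3 * t - DP ^ 2 * quintic t XB YA)
      + (3 + t) * (XB + t * YA) * (?a ^ 3 * (- 1 - t) - DP ^ 2 * quintic (- 1 - t) XB YA))"
    unfolding crank_gf_deriv_root r2.crank_gf_deriv_root t' by (simp add: algebra_simps)
  also have "\<dots> = 5 * (DP * ?R)"
    unfolding quintic_symmetrize[OF t_square] by (simp only: mult_ac)
  finally have "(5 * DP) * (2 * ?a ^ 2 * (euler * ?a) * DP * (XB ^ 2 - XB * YA - YA ^ 2) * weighted_gf)
      = (5 * DP) * ?R"
    using euler_P5 by algebra
  then have "2 * ?a ^ 2 * (euler * ?a) * DP * (XB ^ 2 - XB * YA - YA ^ 2) * weighted_gf = ?R"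
    using nonzero_fps by (simp only: mult_cancel_left) auto
  then show ?thesis unfolding euler_AB by (simp only: power2_eq_square mult_ac)
qed

text \<open>The octic p is the product of the other four factors of \<open>prod_norm_form\<close>.
  It enters squared because the quadratic form does in \<open>weighted_gf_sextic\<close>.\<close>

lemma sextic_mult_octic:
  fixes x y :: "'a::idom"
  defines "p \<equiv> x^8 + x^7*y + 2*x^6*y^2 + 3*x^5*y^3 + 5*x^4*y^4 - 3*x^3*y^5 + 2*x^2*y^6 - x*y^7 + y^8"
  shows "(x ^ 2 - x * y - y ^ 2) * p = x ^ 10 - 11 * x ^ 5 * y ^ 5 - y ^ 10"
    and "p ^ 2 * (x ^ 6 + 3 * x ^ 5 * y + 10 * x ^ 4 * y ^ 2 + 10 * x ^ 2 * y ^ 4 - 3 * x * y ^ 5 + y ^ 6)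
      = x ^ 22 + 5 * x ^ 21 * y + 21 * x ^ 20 * y ^ 2 + 45 * x ^ 19 * y ^ 3 + 110 * x ^ 18 * y ^ 4 + 193 * x ^ 17 * y ^ 5 + 320 * x ^ 16 * y ^ 6 + 348 * x ^ 15 * y ^ 7 + 520 * x ^ 14 * y ^ 8 + 335 * x ^ 13 * y ^ 9 + 359 * x ^ 12 * y ^ 10 + 359 * x ^ 10 * y ^ 12 - 335 * x ^ 9 * y ^ 13 + 520 * x ^ 8 * y ^ 14 - 348 * x ^ 7 * y ^ 15 + 320 * x ^ 6 * y ^ 16 - 193 * x ^ 5 * y ^ 17 + 110 * x ^ 4 * y ^ 18 - 45 * x ^ 3 * y ^ 19 + 21 * x ^ 2 * y ^ 20 - 5 * x * y ^ 21 + y ^ 22"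
    and "p ^ 2 * (x + y)
      = x ^ 17 + 3 * x ^ 16 * y + 7 * x ^ 15 * y ^ 2 + 15 * x ^ 14 * y ^ 3 + 30 * x ^ 13 * y ^ 4 + 36 * x ^ 12 * y ^ 5 + 43 * x ^ 11 * y ^ 6 + 47 * x ^ 10 * y ^ 7 + 35 * x ^ 9 * y ^ 8 - 5 * x ^ 8 * y ^ 9 + 7 * x ^ 7 * y ^ 10 + 11 * x ^ 6 * y ^ 11 + 4 * x ^ 5 * y ^ 12 + 10 * x ^ 4 * y ^ 13 - 5 * x ^ 3 * y ^ 14 + 3 * x ^ 2 * y ^ 15 - x * y ^ 16 + y ^ 17"
  unfolding p_def by algebra+

text \<open>Multiplication by the square of the octic turns the squared quadratic form into the 22nd
  power of \<open>dilate (PA * PB)\<close>. The whole cofactor of \<open>weighted_gf\<close> is then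
  a series in q^5.\<close>

lemma weighted_gf_poly:
  "weighted_gf * (2 * dilate (PA * PB) ^ 24 * DP ^ 2)
    = DP ^ 2 * (XB ^ 22 + 5 * XB ^ 21 * YA + 21 * XB ^ 20 * YA ^ 2 + 45 * XB ^ 19 * YA ^ 3 + 110 * XB ^ 18 * YA ^ 4 + 193 * XB ^ 17 * YA ^ 5 + 320 * XB ^ 16 * YA ^ 6 + 348 * XB ^ 15 * YA ^ 7 + 520 * XB ^ 14 * YA ^ 8 + 335 * XB ^ 13 * YA ^ 9 + 359 * XB ^ 12 * YA ^ 10 + 359 * XB ^ 10 * YA ^ 12 - 335 * XB ^ 9 * YA ^ 13 + 520 * XB ^ 8 * YA ^ 14 - 348 * XB ^ 7 * YA ^ 15 + 320 * XB ^ 6 * YA ^ 16 - 193 * XB ^ 5 * YA ^ 17 + 110 * XB ^ 4 * YA ^ 18 - 45 * XB ^ 3 * YA ^ 19 + 21 * XB ^ 2 * YA ^ 20 - 5 * XB * YA ^ 21 + YA ^ 22)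
      - dilate (PA * PB) ^ 3 * (XB ^ 17 + 3 * XB ^ 16 * YA + 7 * XB ^ 15 * YA ^ 2 + 15 * XB ^ 14 * YA ^ 3 + 30 * XB ^ 13 * YA ^ 4 + 36 * XB ^ 12 * YA ^ 5 + 43 * XB ^ 11 * YA ^ 6 + 47 * XB ^ 10 * YA ^ 7 + 35 * XB ^ 9 * YA ^ 8 - 5 * XB ^ 8 * YA ^ 9 + 7 * XB ^ 7 * YA ^ 10 + 11 * XB ^ 6 * YA ^ 11 + 4 * XB ^ 5 * YA ^ 12 + 10 * XB ^ 4 * YA ^ 13 - 5 * XB ^ 3 * YA ^ 14 + 3 * XB ^ 2 * YA ^ 15 - XB * YA ^ 16 + YA ^ 17)"
proof -
  let ?p = "XB^8 + XB^7*YA + 2*XB^6*YA^2 + 3*XB^5*YA^3 + 5*XB^4*YA^4 - 3*XB^3*YA^5 + 2*XB^2*YA^6 - XB*YA^7 + YA^8"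
  let ?a = "dilate (PA * PB)"
  have q: "(XB ^ 2 - XB * YA - YA ^ 2) * ?p = ?a ^ 11"
    unfolding sextic_mult_octic rogers_ramanujan_dilate ..
  have "weighted_gf * (2 * ?a ^ 24 * DP ^ 2) = 2 * ?a ^ 2 * DP ^ 2 * (?a ^ 11) ^ 2 * weighted_gf"
    by (simp add: mult_ac flip: power_mult power_add)
  also have "\<dots> = ?p ^ 2 * (2 * ?a ^ 2 * DP ^ 2 * (XB ^ 2 - XB * YA - YA ^ 2) ^ 2 * weighted_gf)"
    unfolding q[symmetric] power_mult_distrib by (simp only: mult_ac)
  also have "\<dots> = DP ^ 2 * (?p ^ 2 * (XB ^ 6 + 3 * XB ^ 5 * YA + 10 * XB ^ 4 * YA ^ 2 + 10 * XB ^ 2 * YA ^ 4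
      - 3 * XB * YA ^ 5 + YA ^ 6)) - ?a ^ 3 * (?p ^ 2 * (XB + YA))"
  proof -
    have "p * (D * u - c * v) = D * (p * u) - c * (p * v)" for p D u c v :: "complex fps"
      by (simp add: algebra_simps)
    then show ?thesis unfolding weighted_gf_sextic .
  qed
  finally show ?thesis unfolding sextic_mult_octic .
qed

section \<open>Residue classes and the final comparison\<close>

lemma dissect_mult_dilate: "dissect f * dilate d = dissect (\<lambda>r. f r * d)"
  unfolding dissect_def sum_distrib_right dilate_mult by (simp only: mult.assoc)

lemma weighted_gf_dissect: "weighted_gf = dissect F_series"
proof (rule fps_ext)
  fix n
  have "dissect F_series $ (5 * (n div 5) + n mod 5) = F_series (n mod 5) $ (n div 5)"
    by (rule dissect_nth) simp
  then show "weighted_gf $ n = dissect F_series $ n" by (simp add: F_series_nth)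
qed

text \<open>A power y^(5k+r) is q^r times the dilation of q^k A^(5k+r), so sorting the monomials of
  \<open>weighted_gf_poly\<close> by their exponent of \<open>YA\<close> modulo 5 gives the
  classes.\<close>

lemma F_series_poly:
  "F_series 0 * (2 * (PA * PB) ^ 24 * P5 ^ 2) = P5 ^ 2 * (PB ^ 22 + 193 * fps_X * PB ^ 17 * PA ^ 5 + 359 * fps_X ^ 2 * PB ^ 12 * PA ^ 10 - 348 * fps_X ^ 3 * PB ^ 7 * PA ^ 15 + 21 * fps_X ^ 4 * PB ^ 2 * PA ^ 20) - (PA * PB) ^ 3 * (PB ^ 17 + 36 * fps_X * PB ^ 12 * PA ^ 5 + 7 * fps_X ^ 2 * PB ^ 7 * PA ^ 10 + 3 * fps_X ^ 3 * PB ^ 2 * PA ^ 15)" (is "_ = ?g0")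
  "F_series 3 * (2 * (PA * PB) ^ 24 * P5 ^ 2) = P5 ^ 2 * (45 * PB ^ 19 * PA ^ 3 + 520 * fps_X * PB ^ 14 * PA ^ 8 - 335 * fps_X ^ 2 * PB ^ 9 * PA ^ 13 + 110 * fps_X ^ 3 * PB ^ 4 * PA ^ 18) - (PA * PB) ^ 3 * (15 * PB ^ 14 * PA ^ 3 + 35 * fps_X * PB ^ 9 * PA ^ 8 + 10 * fps_X ^ 2 * PB ^ 4 * PA ^ 13)" (is "_ = ?g3")
  "F_series 4 * (2 * (PA * PB) ^ 24 * P5 ^ 2) = P5 ^ 2 * (110 * PB ^ 18 * PA ^ 4 + 335 * fps_X * PB ^ 13 * PA ^ 9 + 520 * fps_X ^ 2 * PB ^ 8 * PA ^ 14 - 45 * fps_X ^ 3 * PB ^ 3 * PA ^ 19) - (PA * PB) ^ 3 * (30 * PB ^ 13 * PA ^ 4 - 5 * fps_X * PB ^ 8 * PA ^ 9 - 5 * fps_X ^ 2 * PB ^ 3 * PA ^ 14)" (is "_ = ?g4")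
proof -
  \<comment> \<open>Classes 1 and 2 are listed as well, since classes can be compared only between
    two complete dissections.\<close>
  define g where "g = (!) [?g0, P5 ^ 2 * (5 * PB ^ 21 * PA + 320 * fps_X * PB ^ 16 * PA ^ 6 + 320 * fps_X ^ 3 * PB ^ 6 * PA ^ 16 - 5 * fps_X ^ 4 * PB * PA ^ 21) - (PA * PB) ^ 3 * (3 * PB ^ 16 * PA + 43 * fps_X * PB ^ 11 * PA ^ 6 + 11 * fps_X ^ 2 * PB ^ 6 * PA ^ 11 - fps_X ^ 3 * PB * PA ^ 16), P5 ^ 2 * (21 * PB ^ 20 * PA ^ 2 + 348 * fps_X * PB ^ 15 * PA ^ 7 + 359 * fps_X ^ 2 * PB ^ 10 * PA ^ 12 - 193 * fps_X ^ 3 * PB ^ 5 * PA ^ 17 + fps_X ^ 4 * PA ^ 22) - (PA * PB) ^ 3 * (7 * PB ^ 15 * PA ^ 2 + 47 * fps_X * PB ^ 10 * PA ^ 7 + 4 * fps_X ^ 2 * PB ^ 5 * PA ^ 12 + fps_X ^ 3 * PA ^ 17), ?g3, ?g4]"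
  have g: "g 0 = ?g0"
    "g 1 = P5 ^ 2 * (5 * PB ^ 21 * PA + 320 * fps_X * PB ^ 16 * PA ^ 6 + 320 * fps_X ^ 3 * PB ^ 6 * PA ^ 16 - 5 * fps_X ^ 4 * PB * PA ^ 21) - (PA * PB) ^ 3 * (3 * PB ^ 16 * PA + 43 * fps_X * PB ^ 11 * PA ^ 6 + 11 * fps_X ^ 2 * PB ^ 6 * PA ^ 11 - fps_X ^ 3 * PB * PA ^ 16)"
    "g 2 = P5 ^ 2 * (21 * PB ^ 20 * PA ^ 2 + 348 * fps_X * PB ^ 15 * PA ^ 7 + 359 * fps_X ^ 2 * PB ^ 10 * PA ^ 12 - 193 * fps_X ^ 3 * PB ^ 5 * PA ^ 17 + fps_X ^ 4 * PA ^ 22) - (PA * PB) ^ 3 * (7 * PB ^ 15 * PA ^ 2 + 47 * fps_X * PB ^ 10 * PA ^ 7 + 4 * fps_X ^ 2 * PB ^ 5 * PA ^ 12 + fps_X ^ 3 * PA ^ 17)"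
    "g 3 = ?g3" "g 4 = ?g4"
    by (simp_all only: g_def) simp_all
  note dilate_simps = dilate_mult dilate_power dilate_X dilate_numeral
    fps_compose_add_distrib fps_compose_sub_distrib fps_compose_uminus
  have "dissect (\<lambda>r. F_series r * (2 * (PA * PB) ^ 24 * P5 ^ 2))
      = weighted_gf * (2 * dilate (PA * PB) ^ 24 * DP ^ 2)"
    unfolding weighted_gf_dissect DP_def dissect_mult_dilate[symmetric] dilate_simps ..
  also have "\<dots> = dissect g"
    unfolding weighted_gf_poly dissect_expand g
    unfolding DP_def XB_def YA_def dilate_simps
    by algebra
  finally have eq: "dissect (\<lambda>r. F_series r * (2 * (PA * PB) ^ 24 * P5 ^ 2)) = dissect g" .
  show "F_series 0 * (2 * (PA * PB) ^ 24 * P5 ^ 2) = ?g0"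
    "F_series 3 * (2 * (PA * PB) ^ 24 * P5 ^ 2) = ?g3"
    "F_series 4 * (2 * (PA * PB) ^ 24 * P5 ^ 2) = ?g4"
    using dissect_eqD[OF eq, of 0] dissect_eqD[OF eq, of 3] dissect_eqD[OF eq, of 4]
    unfolding g by simp_all
qed

text \<open>Here d is a common denominator with inverse v, and c is the factor that expands n to d.
  The hypotheses make n a unit, so the total division of power series is multiplication by c
  v.\<close>

lemma fps_divide_eq_mult:
  fixes m n c d v :: "'a::field fps"
  assumes "n * c = d" "d * v = 1"
  shows "m / n = m * c * v"
proof -
  have n: "n * (c * v) = 1" using assms by (simp flip: mult.assoc)
  have "n $ 0 * (c * v) $ 0 = 1" using arg_cong[OF n, of "\<lambda>f. f $ 0"] by simp
  then have "n $ 0 \<noteq> 0" by auto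
  then have "inverse n = c * v" using n by (metis fps_inverse_unique)
  then show ?thesis using \<open>n $ 0 \<noteq> 0\<close> by (simp add: fps_divide_unit mult.assoc)
qed

theorem theorem1p3:
  fixes q A B E1 E5 S :: "complex fps"
  assumes "q = fps_X"
    and "A = qpochs [q, q^4] (q^5)"
    and "B = qpochs [q^2, q^3] (q^5)"
    and "E1 = qpoch q q"
    and "E5 = qpoch (q^5) (q^5)"
    and "S = S_series q"
  shows "F_series 0 =
         5 * S * (- 7 * q^3 * (A^6 * E5^9 / (B^8 * E1^12))
            + 12 * q^2 * (A * E5^9 / (B^3 * E1^12))
            - 4 * q * (B^2 * E5^9 / (A^4 * E1^12))
            - 9 * (B^7 * E5^9 / (A^9 * E1^12))
            + 20 * q^2 * (A^4 * E5^7 / (B^5 * E1^12))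
            - 5 * q * (E5^7 / (A * E1^12))
            + 5 * (B^5 * E5^7 / (A^6 * E1^12)))
         + 10 * q^2 * (A^4 * E5^8 / (B^4 * E1^12))
         - fps_const (5/2) * q * (B * E5^8 / (A * E1^12))
         + fps_const (5/2) * (B^6 * E5^8 / (A^6 * E1^12))
         - fps_const (305/2) * q^3 * (A^3 * E5^12 / (B^5 * E1^12))
         + fps_const (335/2) * q^2 * (E5^12 / (A^2 * E1^12))
         + 85 * q * (B^5 * E5^12 / (A^7 * E1^12))
         + 5 * (B^10 * E5^12 / (A^12 * E1^12))
         + 25 * q^3 * (A^6 * E5^10 / (B^7 * E1^12))
         - 15 * q^2 * (A * E5^10 / (B^2 * E1^12))
         - 10 * q * (B^3 * E5^10 / (A^4 * E1^12))
         - fps_const (15/2) * (B^8 * E5^10 / (A^9 * E1^12))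
    \<and> F_series 3 =
         55 * q^3 * (A^6 * E5^12 / (B^8 * E1^12))
         - fps_const (335/2) * q^2 * (A * E5^12 / (B^3 * E1^12))
         + 260 * q * (B^2 * E5^12 / (A^4 * E1^12))
         + fps_const (45/2) * (B^7 * E5^12 / (A^9 * E1^12))
         - 5 * q^2 * (A^4 * E5^10 / (B^5 * E1^12))
         - fps_const (35/2) * q * (E5^10 / (A * E1^12))
         - fps_const (15/2) * (B^5 * E5^10 / (A^6 * E1^12))
    \<and> F_series 4 =
         - fps_const (45/2) * q^3 * (A^7 * E5^12 / (B^9 * E1^12))
         + 260 * q^2 * (A^2 * E5^12 / (B^4 * E1^12))
         + fps_const (335/2) * q * (B * E5^12 / (A^3 * E1^12))
         + 55 * (B^6 * E5^12 / (A^8 * E1^12))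
         + fps_const (5/2) * q^2 * (A^5 * E5^10 / (B^6 * E1^12))
         + fps_const (5/2) * q * (E5^10 / (B * E1^12))
         - 15 * (B^4 * E5^10 / (A^5 * E1^12))"
proof -
  have A: "A = PA" and B: "B = PB" and P: "E5 = P5" and S: "S = theta_moment1"
    using assms by (simp_all add: PA_def PB_def P5_def S_series_eq)
  have E: "E1 = A * B * E5"
    using assms euler_eq unfolding A B P by (simp add: euler_def)
  \<comment> \<open>E1^12 supplies A^12 B^12 E5^12, the additional powers of A and B are at most 12,
    and E5^2 comes from \<open>F_series_poly\<close>.\<close>
  let ?D = "A ^ 24 * B ^ 24 * E5 ^ 14"
  \<comment> \<open>The half-integers of the theorem become multiples of an element h with 2 h = 1,
    a relation that \<open>algebra\<close> can use.\<close>
  define v h where "v = inverse ?D" and "h = (fps_const (1 / 2) :: complex fps)"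
  have v: "?D * v = 1"
    unfolding v_def A B P by (rule inverse_mult_eq_1') (simp add: nth_0)
  have half: "2 * h = 1" unfolding h_def by (simp add: numeral_fps_const)
  have h: "fps_const (numeral k / 2) = numeral k * h" for k
    unfolding h_def by (simp add: numeral_fps_const)
  have pow: "x ^ b * x ^ (12 - b) = x ^ 12" if "b \<le> 12" for x :: "complex fps" and b
    using that by (simp flip: power_add)
  have divA: "m / (A ^ b * E1 ^ 12) = m * (A ^ (12 - b) * B ^ 12 * E5 ^ 2) * v" if "b \<le> 12" for m b
  proof (rule fps_divide_eq_mult[OF _ v])
    have "A ^ b * E1 ^ 12 * (A ^ (12 - b) * B ^ 12 * E5 ^ 2)
        = (A ^ b * A ^ (12 - b)) * A ^ 12 * (B ^ 12 * B ^ 12) * (E5 ^ 12 * E5 ^ 2)"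
      unfolding E power_mult_distrib by (simp only: mult_ac)
    then show "A ^ b * E1 ^ 12 * (A ^ (12 - b) * B ^ 12 * E5 ^ 2) = ?D"
      unfolding pow[OF that] by (simp flip: power_add)
  qed
  have divB: "m / (B ^ b * E1 ^ 12) = m * (A ^ 12 * B ^ (12 - b) * E5 ^ 2) * v" if "b \<le> 12" for m b
  proof (rule fps_divide_eq_mult[OF _ v])
    have "B ^ b * E1 ^ 12 * (A ^ 12 * B ^ (12 - b) * E5 ^ 2)
        = (B ^ b * B ^ (12 - b)) * B ^ 12 * (A ^ 12 * A ^ 12) * (E5 ^ 12 * E5 ^ 2)"
      unfolding E power_mult_distrib by (simp only: mult_ac)
    then show "B ^ b * E1 ^ 12 * (A ^ 12 * B ^ (12 - b) * E5 ^ 2) = ?D"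
      unfolding pow[OF that] by (simp flip: power_add mult.assoc)
  qed
  have div: "m / (A * E1 ^ 12) = m * (A ^ 11 * B ^ 12 * E5 ^ 2) * v"
    "m / (B * E1 ^ 12) = m * (A ^ 12 * B ^ 11 * E5 ^ 2) * v" for m
    using divA[of 1 m] divB[of 1 m] by simp_all
  note quotients = div
    divA[of 2, simplified] divA[of 3, simplified] divA[of 4, simplified] divA[of 5, simplified]
    divA[of 6, simplified] divA[of 7, simplified] divA[of 8, simplified] divA[of 9, simplified]
    divA[of 12, simplified]
    divB[of 2, simplified] divB[of 3, simplified] divB[of 4, simplified] divB[of 5, simplified]
    divB[of 6, simplified] divB[of 7, simplified] divB[of 8, simplified] divB[of 9, simplified]
  have nz: "A \<noteq> 0" "B \<noteq> 0" "E5 \<noteq> 0" unfolding A B P by (rule nonzero_fps)+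
  \<comment> \<open>The 2 clears h and (A B)^3 clears the denominator of S. Both are cancelled here,
    so each claim is left with one polynomial identity.\<close>
  have solve: "F = R * v" if "F * (2 * (A * B) ^ 24 * E5 ^ 2) = N"
    and "2 * (A * B) ^ 3 * R = (A * B) ^ 3 * E5 ^ 12 * N" for F R N
  proof -
    have "(2 * (A * B) ^ 3) * R = (A * B) ^ 3 * E5 ^ 12 * (F * (2 * (A * B) ^ 24 * E5 ^ 2))"
      by (simp only: that)
    also have "\<dots> = (2 * (A * B) ^ 3) * (F * ?D)"
      by algebra
    finally have "(2 * (A * B) ^ 3) * R = (2 * (A * B) ^ 3) * (F * ?D)" .
    then have "R = F * ?D" using nz by (simp only: mult_cancel_left) auto
    then show ?thesis using v by (simp add: mult.assoc)
  qed
  note F = F_series_poly[folded A B P]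
  \<comment> \<open>S enters F_0 linearly with the coefficient 5; with the 2 of \<open>solve\<close>
    this becomes the 10 S evaluated here.\<close>
  have S': "(10 * S + B * E5) * (A * B) ^ 3 = E5 ^ 3 * (B ^ 6 - 3 * fps_X * B * A ^ 5)"
    unfolding S A B P by (rule theta_moments)
  have F0: "F_series 0 = (5 * S * (- 7 * fps_X^3 * (A^6 * E5^9 * A^12 * B^4 * E5^2)
            + 12 * fps_X^2 * (A * E5^9 * A^12 * B^9 * E5^2)
            - 4 * fps_X * (B^2 * E5^9 * A^8 * B^12 * E5^2)
            - 9 * (B^7 * E5^9 * A^3 * B^12 * E5^2)
            + 20 * fps_X^2 * (A^4 * E5^7 * A^12 * B^7 * E5^2)
            - 5 * fps_X * (E5^7 * A^11 * B^12 * E5^2)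
            + 5 * (B^5 * E5^7 * A^6 * B^12 * E5^2))
         + 10 * fps_X^2 * (A^4 * E5^8 * A^12 * B^8 * E5^2)
         - 5 * h * fps_X * (B * E5^8 * A^11 * B^12 * E5^2)
         + 5 * h * (B^6 * E5^8 * A^6 * B^12 * E5^2)
         - 305 * h * fps_X^3 * (A^3 * E5^12 * A^12 * B^7 * E5^2)
         + 335 * h * fps_X^2 * (E5^12 * A^10 * B^12 * E5^2)
         + 85 * fps_X * (B^5 * E5^12 * A^5 * B^12 * E5^2)
         + 5 * (B^10 * E5^12 * B^12 * E5^2)
         + 25 * fps_X^3 * (A^6 * E5^10 * A^12 * B^5 * E5^2)
         - 15 * fps_X^2 * (A * E5^10 * A^12 * B^10 * E5^2)
         - 10 * fps_X * (B^3 * E5^10 * A^8 * B^12 * E5^2)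
         - 15 * h * (B^8 * E5^10 * A^3 * B^12 * E5^2)) * v"
  by (rule solve[OF F(1)]) (use S' half in algebra)
  have F3: "F_series 3 = (55 * fps_X^3 * (A^6 * E5^12 * A^12 * B^4 * E5^2)
         - 335 * h * fps_X^2 * (A * E5^12 * A^12 * B^9 * E5^2)
         + 260 * fps_X * (B^2 * E5^12 * A^8 * B^12 * E5^2)
         + 45 * h * (B^7 * E5^12 * A^3 * B^12 * E5^2)
         - 5 * fps_X^2 * (A^4 * E5^10 * A^12 * B^7 * E5^2)
         - 35 * h * fps_X * (E5^10 * A^11 * B^12 * E5^2)
         - 15 * h * (B^5 * E5^10 * A^6 * B^12 * E5^2)) * v"
  by (rule solve[OF F(2)]) (use half in algebra)
  have F4: "F_series 4 = (- 45 * h * fps_X^3 * (A^7 * E5^12 * A^12 * B^3 * E5^2)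
         + 260 * fps_X^2 * (A^2 * E5^12 * A^12 * B^8 * E5^2)
         + 335 * h * fps_X * (B * E5^12 * A^9 * B^12 * E5^2)
         + 55 * (B^6 * E5^12 * A^4 * B^12 * E5^2)
         + 5 * h * fps_X^2 * (A^5 * E5^10 * A^12 * B^6 * E5^2)
         + 5 * h * fps_X * (E5^10 * A^12 * B^11 * E5^2)
         - 15 * (B^4 * E5^10 * A^7 * B^12 * E5^2)) * v"
  by (rule solve[OF F(3)]) (use half in algebra)
  show ?thesis
    unfolding assms(1) h quotients F0 F3 F4 by (intro conjI; algebra)
qed

end
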